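(* Let $F$ be a field, let $M$ be a countable $\omega$-categorical Ramsey structure, let $G=\mathrm{Aut}(M)$, and let $W$ be a sort in $M^{eq}$. Let $F[W]\le F^W$ be the topological subspace of definable functions. Then the maps $$U\mapsto U^\perp=\{x\in FW: f(x)=0\text{ for all } f\in U\}\le FW$$ and $$X\mapsto X^\perp\cap F[W],\quad\text{where } X^\perp=\{f\in F^W: f(x)=0\text{ for all }x\in X\},$$ give an inclusion-reversing correspondence (mutually inverse, inclusion-reversing bijections) between the closed $G$-invariant subspaces $U$ of $F[W]$ and the $G$-submodules $X$ of $FW$.
   Context: $FW$ is the $F$-vector space with basis $W$, with $G$ acting by extending its permutation action on $W$ linearly; $G$-submodules are $G$-invariant subspaces. $F^W$ is the space of all functions $W\to F$ with the topology of pointwise convergence ($F$ discrete) and $G$-action $(gf)(w)=f(g^{-1}w)$. For $f\in F^W$ and $v=\sum_w\alpha_w w\in FW$, $f(v)=\sum_w\alpha_w f(w)$. A function $f\in F^W$ is definable if there is a finite $C\subseteq M$ such that $f$ is constant on $G_{(C)}$-orbits on $W$, where $G_{(C)}$ is the pointwise stabiliser of $C$ in $G$. $F[W]$ is the set of definable functions, with the subspace topology from $F^W$; "closed" subspaces of $F[W]$ are closed in this topology. $M^{eq}$: the imaginary elements of $M$, i.e. equivalence classes of $\emptyset$-definable equivalence relations $E$ on $\emptyset$-definable subsets $D\subseteq M^n$ ($n\in\mathbb{N}$); $G$ acts on $M^{eq}$. Up to interdefinability, a sort in $M^{eq}$ is the same as a finite union of $G$-orbits on $M^{eq}$ (for example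 $M^n$). $M$ countably infinite is $\omega$-categorical iff $\mathrm{Aut}(M)$ has finitely many orbits on $M^n$ for all $n$. A Ramsey structure is a countable Fraïssé structure $M$ (locally finite, every isomorphism between finite substructures extends to an automorphism of $M$) whose age (the class of finite structures embeddable in $M$) is a Ramsey class of rigid structures (i.e. with trivial automorphism group). A class $\mathcal{C}$ of finite structures is a Ramsey class if it is closed under isomorphisms and substructures and for all $k\in\mathbb{N}$ and $A\subseteq B\in\mathcal{C}$ there is $B\subseteq C\in\mathcal{C}$ such that for every $k$-colouring of the set $\binom{C}{A}$ of substructures of $C$ isomorphic to $A$ there is a copy $B'$ of $B$ in $C$ such that the colouring is constant on $\binom{B'}{A}$. *)

theory Defs
  imports "HOL-Analysis.Analysis" "HOL-Library.Poly_Mapping"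
begin

section \<open>First-order structures\<close>

text \<open>
  A language carries explicit \<^emph>\<open>sets\<close> of symbols, because HOL types are nonempty and a language
  may have no function (or no relation) symbols. Constants are function symbols of arity 0.
\<close>

record ('f, 'r) lang =
  fsyms :: "'f set"
  rsyms :: "'r set"
  farity :: "'f \<Rightarrow> nat"
  rarity :: "'r \<Rightarrow> nat"

record ('a, 'f, 'r) struct =
  univ :: "'a set"
  fn :: "'f \<Rightarrow> 'a list \<Rightarrow> 'a"
  rel :: "'r \<Rightarrow> 'a list set"

definition tuples :: "'a set \<Rightarrow> nat \<Rightarrow> 'a list set" where
  "tuples S n = {xs. length xs = n \<and> set xs \<subseteq> S}"

text \<open>
  Interpretations are normalised outside their domain (functions are extensional, relations only
  contain tuples of the right length), so that equal universes and equal interpretations in the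
  mathematical sense mean equality of records. In particular a substructure is determined by its
  universe, which matters when substructures are coloured below.
\<close>

definition is_struct :: "('f, 'r) lang \<Rightarrow> ('a, 'f, 'r) struct \<Rightarrow> bool" where
  "is_struct L A \<longleftrightarrow>
     (\<forall>f\<in>fsyms L. fn A f \<in> tuples (univ A) (farity L f) \<rightarrow>\<^sub>E univ A) \<and>
     (\<forall>f. f \<notin> fsyms L \<longrightarrow> fn A f = (\<lambda>_. undefined)) \<and>
     (\<forall>R\<in>rsyms L. rel A R \<subseteq> tuples (univ A) (rarity L R)) \<and>
     (\<forall>R. R \<notin> rsyms L \<longrightarrow> rel A R = {})"

definition substructure ::
  "('f, 'r) lang \<Rightarrow> ('a, 'f, 'r) struct \<Rightarrow> ('a, 'f, 'r) struct \<Rightarrow> bool" where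
  "substructure L A B \<longleftrightarrow>
     is_struct L A \<and> is_struct L B \<and> univ A \<subseteq> univ B \<and>
     (\<forall>f\<in>fsyms L. \<forall>xs\<in>tuples (univ A) (farity L f). fn A f xs = fn B f xs) \<and>
     (\<forall>R\<in>rsyms L. \<forall>xs\<in>tuples (univ A) (rarity L R). xs \<in> rel A R \<longleftrightarrow> xs \<in> rel B R)"

definition embedding ::
  "('f, 'r) lang \<Rightarrow> ('a, 'f, 'r) struct \<Rightarrow> ('b, 'f, 'r) struct \<Rightarrow> ('a \<Rightarrow> 'b) \<Rightarrow> bool" where
  "embedding L A B h \<longleftrightarrow>
     h ` univ A \<subseteq> univ B \<and> inj_on h (univ A) \<and>
     (\<forall>f\<in>fsyms L. \<forall>xs\<in>tuples (univ A) (farity L f). h (fn A f xs) = fn B f (map h xs)) \<and>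
     (\<forall>R\<in>rsyms L. \<forall>xs\<in>tuples (univ A) (rarity L R). xs \<in> rel A R \<longleftrightarrow> map h xs \<in> rel B R)"

definition isomorphism ::
  "('f, 'r) lang \<Rightarrow> ('a, 'f, 'r) struct \<Rightarrow> ('b, 'f, 'r) struct \<Rightarrow> ('a \<Rightarrow> 'b) \<Rightarrow> bool" where
  "isomorphism L A B h \<longleftrightarrow> embedding L A B h \<and> h ` univ A = univ B"

definition isomorphic ::
  "('f, 'r) lang \<Rightarrow> ('a, 'f, 'r) struct \<Rightarrow> ('b, 'f, 'r) struct \<Rightarrow> bool" where
  "isomorphic L A B \<longleftrightarrow> (\<exists>h. isomorphism L A B h)"

definition aut :: "('f, 'r) lang \<Rightarrow> ('a, 'f, 'r) struct \<Rightarrow> ('a \<Rightarrow> 'a) set" where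
  "aut L A = {g \<in> extensional (univ A). isomorphism L A A g}"

definition orbit :: "'g set \<Rightarrow> ('g \<Rightarrow> 'x \<Rightarrow> 'x) \<Rightarrow> 'x \<Rightarrow> 'x set" where
  "orbit H act x = (\<lambda>g. act g x) ` H"


section \<open>Formulas and definable sets\<close>

datatype 'f trm = Var nat | App 'f "'f trm list"

datatype ('f, 'r) fm =
    Eq "'f trm" "'f trm"
  | Rel 'r "'f trm list"
  | Neg "('f, 'r) fm"
  | Conj "('f, 'r) fm" "('f, 'r) fm"
  | Ex nat "('f, 'r) fm"

primrec trm_wf :: "('f, 'r) lang \<Rightarrow> 'f trm \<Rightarrow> bool" where
  "trm_wf L (Var i) = True"
| "trm_wf L (App f ts) = (f \<in> fsyms L \<and> length ts = farity L f \<and> list_all (trm_wf L) ts)"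

primrec fm_wf :: "('f, 'r) lang \<Rightarrow> ('f, 'r) fm \<Rightarrow> bool" where
  "fm_wf L (Eq s t) = (trm_wf L s \<and> trm_wf L t)"
| "fm_wf L (Rel R ts) = (R \<in> rsyms L \<and> length ts = rarity L R \<and> list_all (trm_wf L) ts)"
| "fm_wf L (Neg p) = fm_wf L p"
| "fm_wf L (Conj p q) = (fm_wf L p \<and> fm_wf L q)"
| "fm_wf L (Ex i p) = fm_wf L p"

primrec trm_vars :: "'f trm \<Rightarrow> nat set" where
  "trm_vars (Var i) = {i}"
| "trm_vars (App f ts) = \<Union> (set (map trm_vars ts))"

primrec fm_free :: "('f, 'r) fm \<Rightarrow> nat set" where
  "fm_free (Eq s t) = trm_vars s \<union> trm_vars t"
| "fm_free (Rel R ts) = \<Union> (set (map trm_vars ts))"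
| "fm_free (Neg p) = fm_free p"
| "fm_free (Conj p q) = fm_free p \<union> fm_free q"
| "fm_free (Ex i p) = fm_free p - {i}"

primrec trm_val :: "('a, 'f, 'r) struct \<Rightarrow> (nat \<Rightarrow> 'a) \<Rightarrow> 'f trm \<Rightarrow> 'a" where
  "trm_val M e (Var i) = e i"
| "trm_val M e (App f ts) = fn M f (map (trm_val M e) ts)"

primrec sat :: "('a, 'f, 'r) struct \<Rightarrow> (nat \<Rightarrow> 'a) \<Rightarrow> ('f, 'r) fm \<Rightarrow> bool" where
  "sat M e (Eq s t) = (trm_val M e s = trm_val M e t)"
| "sat M e (Rel R ts) = (map (trm_val M e) ts \<in> rel M R)"
| "sat M e (Neg p) = (\<not> sat M e p)"
| "sat M e (Conj p q) = (sat M e p \<and> sat M e q)"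
| "sat M e (Ex i p) = (\<exists>a\<in>univ M. sat M (e(i := a)) p)"

text \<open>\<open>\<emptyset>\<close>-definability; the free variables are bounded, so \<open>xs ! i\<close> is never used out of range.\<close>

definition definable_set ::
  "('f, 'r) lang \<Rightarrow> ('a, 'f, 'r) struct \<Rightarrow> nat \<Rightarrow> 'a list set \<Rightarrow> bool" where
  "definable_set L M n D \<longleftrightarrow>
     (\<exists>p. fm_wf L p \<and> fm_free p \<subseteq> {..<n} \<and> D = {xs \<in> tuples (univ M) n. sat M (\<lambda>i. xs ! i) p})"


section \<open>Imaginaries and sorts\<close>

text \<open>
  A binary relation on \<open>n\<close>-tuples is definable if it is definable as a set of \<open>2n\<close>-tuples.
\<close>

definition meq :: "('f, 'r) lang \<Rightarrow> ('a, 'f, 'r) struct \<Rightarrow> 'a list set set" where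
  "meq L M = {c. \<exists>n D E. definable_set L M n D \<and>
     definable_set L M (2 * n) {xs @ ys | xs ys. (xs, ys) \<in> E} \<and> equiv D E \<and> c \<in> D // E}"

definition meq_act :: "('a \<Rightarrow> 'a) \<Rightarrow> 'a list set \<Rightarrow> 'a list set" where
  "meq_act g c = map g ` c"

text \<open>Up to interdefinability, the sorts are the finite unions of orbits of imaginaries.\<close>

definition is_sort :: "('f, 'r) lang \<Rightarrow> ('a, 'f, 'r) struct \<Rightarrow> 'a list set set \<Rightarrow> bool" where
  "is_sort L M W \<longleftrightarrow>
     (\<exists>S. finite S \<and> S \<subseteq> meq L M \<and> W = (\<Union>c\<in>S. orbit (aut L M) meq_act c))"


section \<open>\<open>\<omega>\<close>-categorical structures and Ramsey structures\<close>

text \<open>\<open>\<omega>\<close>-categoricity in its Ryll-Nardzewski form.\<close>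

definition omega_categorical :: "('f, 'r) lang \<Rightarrow> ('a, 'f, 'r) struct \<Rightarrow> bool" where
  "omega_categorical L M \<longleftrightarrow> countable (univ M) \<and> infinite (univ M) \<and>
     (\<forall>n. finite (orbit (aut L M) map ` tuples (univ M) n))"

definition generated_univ ::
  "('f, 'r) lang \<Rightarrow> ('a, 'f, 'r) struct \<Rightarrow> 'a set \<Rightarrow> 'a set" where
  "generated_univ L M S = \<Inter> {T. S \<subseteq> T \<and> T \<subseteq> univ M \<and>
     (\<forall>f\<in>fsyms L. \<forall>xs\<in>tuples T (farity L f). fn M f xs \<in> T)}"

definition locally_finite :: "('f, 'r) lang \<Rightarrow> ('a, 'f, 'r) struct \<Rightarrow> bool" where
  "locally_finite L M \<longleftrightarrow> (\<forall>S. finite S \<and> S \<subseteq> univ M \<longrightarrow> finite (generated_univ L M S))"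

definition fraisse_structure :: "('f, 'r) lang \<Rightarrow> ('a, 'f, 'r) struct \<Rightarrow> bool" where
  "fraisse_structure L M \<longleftrightarrow> locally_finite L M \<and>
     (\<forall>A B h. substructure L A M \<and> substructure L B M \<and> finite (univ A) \<and> finite (univ B) \<and>
        isomorphism L A B h \<longrightarrow> (\<exists>g\<in>aut L M. \<forall>x\<in>univ A. g x = h x))"

text \<open>
  The age is represented by its members with universe a finite set of natural numbers; up to
  isomorphism these are all its members.
\<close>

definition age :: "('f, 'r) lang \<Rightarrow> ('a, 'f, 'r) struct \<Rightarrow> (nat, 'f, 'r) struct set" where
  "age L M = {A. is_struct L A \<and> finite (univ A) \<and> (\<exists>h. embedding L A M h)}"

definition copies ::
  "('f, 'r) lang \<Rightarrow> ('a, 'f, 'r) struct \<Rightarrow> ('a, 'f, 'r) struct \<Rightarrow> ('a, 'f, 'r) struct set" where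
  "copies L C A = {A'. substructure L A' C \<and> isomorphic L A' A}"

definition ramsey_class :: "('f, 'r) lang \<Rightarrow> ('a, 'f, 'r) struct set \<Rightarrow> bool" where
  "ramsey_class L K \<longleftrightarrow>
     (\<forall>A\<in>K. is_struct L A \<and> finite (univ A)) \<and>
     (\<forall>A\<in>K. \<forall>B. is_struct L B \<and> isomorphic L A B \<longrightarrow> B \<in> K) \<and>
     (\<forall>B\<in>K. \<forall>A. substructure L A B \<longrightarrow> A \<in> K) \<and>
     (\<forall>k::nat. \<forall>A B. B \<in> K \<and> substructure L A B \<longrightarrow>
        (\<exists>C\<in>K. substructure L B C \<and>
          (\<forall>col\<in>(copies L C A \<rightarrow> {..<k}).
             \<exists>B'\<in>copies L C B. \<exists>i. \<forall>A'\<in>copies L B' A. col A' = i)))"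

definition rigid :: "('f, 'r) lang \<Rightarrow> ('a, 'f, 'r) struct \<Rightarrow> bool" where
  "rigid L A \<longleftrightarrow> (\<forall>g\<in>aut L A. \<forall>x\<in>univ A. g x = x)"

definition ramsey_structure :: "('f, 'r) lang \<Rightarrow> ('a, 'f, 'r) struct \<Rightarrow> bool" where
  "ramsey_structure L M \<longleftrightarrow> countable (univ M) \<and> fraisse_structure L M \<and>
     ramsey_class L (age L M) \<and> (\<forall>A\<in>age L M. rigid L A)"


section \<open>The permutation module \<open>FW\<close>\<close>

text \<open>
  Elements of \<open>FW\<close> are the finitely supported maps with all keys in \<open>W\<close>.
\<close>

definition fw_scale :: "'k::field \<Rightarrow> ('w \<Rightarrow>\<^sub>0 'k) \<Rightarrow> ('w \<Rightarrow>\<^sub>0 'k)" where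
  "fw_scale c v = Poly_Mapping.map ((*) c) v"

lemma lookup_fw_scale [simp]: "Poly_Mapping.lookup (fw_scale c v) w = c * Poly_Mapping.lookup v w"
  by (simp add: fw_scale_def Poly_Mapping.map.rep_eq when_def)

global_interpretation fw: vector_space "fw_scale :: 'k::field \<Rightarrow> ('w \<Rightarrow>\<^sub>0 'k) \<Rightarrow> ('w \<Rightarrow>\<^sub>0 'k)"
  by unfold_locales (auto intro!: poly_mapping_eqI simp: lookup_add algebra_simps)

definition FW :: "'w set \<Rightarrow> ('w \<Rightarrow>\<^sub>0 'k::field) set" where
  "FW W = {v. Poly_Mapping.keys v \<subseteq> W}"

definition fw_act ::
  "('a \<Rightarrow> 'a) \<Rightarrow> ('a list set \<Rightarrow>\<^sub>0 'k::field) \<Rightarrow> ('a list set \<Rightarrow>\<^sub>0 'k)" where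
  "fw_act g v =
     (\<Sum>w\<in>Poly_Mapping.keys v. Poly_Mapping.single (meq_act g w) (Poly_Mapping.lookup v w))"

definition G_submodules ::
  "('f, 'r) lang \<Rightarrow> ('a, 'f, 'r) struct \<Rightarrow> 'a list set set \<Rightarrow>
   ('a list set \<Rightarrow>\<^sub>0 'k::field) set set" where
  "G_submodules L M W =
     {X. X \<subseteq> FW W \<and> fw.subspace X \<and> (\<forall>g\<in>aut L M. \<forall>x\<in>X. fw_act g x \<in> X)}"


section \<open>Functions on \<open>W\<close>\<close>

text \<open>\<open>F\<^sup>W\<close> consists of the extensional functions on \<open>W\<close>, with the product topology.\<close>

definition fun_topology :: "'w set \<Rightarrow> ('w \<Rightarrow> 'k::field) topology" where
  "fun_topology W = product_topology (\<lambda>_. discrete_topology UNIV) W"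

definition fun_subspace :: "'w set \<Rightarrow> ('w \<Rightarrow> 'k::field) set \<Rightarrow> bool" where
  "fun_subspace W U \<longleftrightarrow> U \<subseteq> (W \<rightarrow>\<^sub>E UNIV) \<and> (\<lambda>w\<in>W. 0) \<in> U \<and>
     (\<forall>f\<in>U. \<forall>h\<in>U. (\<lambda>w\<in>W. f w + h w) \<in> U) \<and> (\<forall>c. \<forall>f\<in>U. (\<lambda>w\<in>W. c * f w) \<in> U)"

text \<open>
  \<open>(g f)(w) = f (g\<^sup>-\<^sup>1 w)\<close>; all tuples in members of \<open>w\<close> lie over \<open>univ M\<close>, where
  \<open>inv_into (univ M) g\<close> is the inverse of the automorphism \<open>g\<close>.
\<close>

definition fun_act ::
  "('a, 'f, 'r) struct \<Rightarrow> 'a list set set \<Rightarrow> ('a \<Rightarrow> 'a) \<Rightarrow>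
   ('a list set \<Rightarrow> 'k::field) \<Rightarrow> ('a list set \<Rightarrow> 'k)" where
  "fun_act M W g f = (\<lambda>w\<in>W. f (meq_act (inv_into (univ M) g) w))"

definition pt_stab :: "('f, 'r) lang \<Rightarrow> ('a, 'f, 'r) struct \<Rightarrow> 'a set \<Rightarrow> ('a \<Rightarrow> 'a) set" where
  "pt_stab L M C = {g \<in> aut L M. \<forall>x\<in>C. g x = x}"

definition definable_funs ::
  "('f, 'r) lang \<Rightarrow> ('a, 'f, 'r) struct \<Rightarrow> 'a list set set \<Rightarrow> ('a list set \<Rightarrow> 'k::field) set" where
  "definable_funs L M W = {f \<in> W \<rightarrow>\<^sub>E UNIV. \<exists>C. finite C \<and> C \<subseteq> univ M \<and>
     (\<forall>w\<in>W. \<forall>w'\<in>orbit (pt_stab L M C) meq_act w. f w' = f w)}"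

definition closed_G_subspaces ::
  "('f, 'r) lang \<Rightarrow> ('a, 'f, 'r) struct \<Rightarrow> 'a list set set \<Rightarrow>
   ('a list set \<Rightarrow> 'k::field) set set" where
  "closed_G_subspaces L M W = {U. U \<subseteq> definable_funs L M W \<and> fun_subspace W U \<and>
     (\<forall>g\<in>aut L M. \<forall>f\<in>U. fun_act M W g f \<in> U) \<and>
     closedin (subtopology (fun_topology W) (definable_funs L M W)) U}"


section \<open>Annihilators\<close>

definition pairing :: "('w \<Rightarrow> 'k::field) \<Rightarrow> ('w \<Rightarrow>\<^sub>0 'k) \<Rightarrow> 'k" where
  "pairing f v = (\<Sum>w\<in>Poly_Mapping.keys v. Poly_Mapping.lookup v w * f w)"

definition perp_of_funs :: "'w set \<Rightarrow> ('w \<Rightarrow> 'k::field) set \<Rightarrow> ('w \<Rightarrow>\<^sub>0 'k) set" where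
  "perp_of_funs W U = {x \<in> FW W. \<forall>f\<in>U. pairing f x = 0}"

definition perp_of_vecs :: "'w set \<Rightarrow> ('w \<Rightarrow>\<^sub>0 'k::field) set \<Rightarrow> ('w \<Rightarrow> 'k) set" where
  "perp_of_vecs W X = {f \<in> W \<rightarrow>\<^sub>E UNIV. \<forall>x\<in>X. pairing f x = 0}"

end

theory Submission
  imports Defs
begin

text \<open>
  That a closed \<open>U\<close> is recovered from its annihilator is finite-dimensional duality. For a
  submodule \<open>X\<close> and \<open>v \<notin> X\<close> one needs a definable \<open>f\<close> in the annihilator of \<open>X\<close> with \<open>f v \<noteq> 0\<close>. Let
  \<open>H\<close> be the pointwise stabiliser of a finite support of \<open>v\<close>. Such an \<open>f\<close>, constant on the orbits of \<open>H\<close>,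
  exists unless \<open>v = x + (\<Sum>i. r\<^sub>i (h\<^sub>i w\<^sub>i - w\<^sub>i))\<close> with \<open>x \<in> X\<close> and \<open>h\<^sub>i \<in> H\<close>. In the latter case take
  any linear \<open>\<psi>\<close> vanishing on \<open>X\<close> with \<open>\<psi> v = 1\<close>; then \<open>\<Sum>i. \<psi> (r\<^sub>i g h\<^sub>i w\<^sub>i) - \<psi> (r\<^sub>i g w\<^sub>i) = 1\<close> for all
  \<open>g \<in> H\<close>. An additive character of the field that is nontrivial at \<open>1\<close> yields a finite colouring of
  the field for which \<open>1\<close> is not a sum of this many monochromatic differences, whereas the Ramsey
  property provides a \<open>g\<close> for which all the differences are monochromatic. Compactness, available
  only over finite fields, is thereby avoided.
\<close>

subsection \<open>Substructures, embeddings and automorphisms\<close>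

definition fn_closed :: "('f, 'r) lang \<Rightarrow> ('a, 'f, 'r) struct \<Rightarrow> 'a set \<Rightarrow> bool" where
  "fn_closed L M T \<longleftrightarrow> (\<forall>f\<in>fsyms L. \<forall>xs\<in>tuples T (farity L f). fn M f xs \<in> T)"

text \<open>Everything outside \<open>T\<close> and outside the symbols of \<open>L\<close> is reset
  to the default value, as the normalisation in \<open>is_struct\<close> demands; equality of
  records is then equality of substructures.\<close>

definition restr :: "('f, 'r) lang \<Rightarrow> ('a, 'f, 'r) struct \<Rightarrow> 'a set \<Rightarrow> ('a, 'f, 'r) struct" where
  "restr L M T = \<lparr>univ = T,
     fn = (\<lambda>f. if f \<in> fsyms L then restrict (fn M f) (tuples T (farity L f)) else (\<lambda>_. undefined)),
     rel = (\<lambda>R. if R \<in> rsyms L then rel M R \<inter> tuples T (rarity L R) else {})\<rparr>"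

lemma univ_restr [simp]: "univ (restr L M T) = T"
  by (simp add: restr_def)

lemma map_in_tuples: "xs \<in> tuples S n \<Longrightarrow> h ` S \<subseteq> T \<Longrightarrow> map h xs \<in> tuples T n"
  by (auto simp: tuples_def)

lemma map_cong_tuples: "xs \<in> tuples S n \<Longrightarrow> (\<And>x. x \<in> S \<Longrightarrow> h x = k x) \<Longrightarrow> map h xs = map k xs"
  by (auto simp: tuples_def)

lemma tuples_mono: "S \<subseteq> T \<Longrightarrow> tuples S n \<subseteq> tuples T n"
  by (auto simp: tuples_def)

lemma fn_in_univ:
  "is_struct L A \<Longrightarrow> f \<in> fsyms L \<Longrightarrow> xs \<in> tuples (univ A) (farity L f) \<Longrightarrow> fn A f xs \<in> univ A"
  by (auto simp: is_struct_def)

lemma rel_subset_tuples: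
  "is_struct L A \<Longrightarrow> R \<in> rsyms L \<Longrightarrow> rel A R \<subseteq> tuples (univ A) (rarity L R)"
  by (auto simp: is_struct_def)

lemma substructure_restr:
  assumes "is_struct L M" "T \<subseteq> univ M" "fn_closed L M T"
  shows "substructure L (restr L M T) M"
  using assms tuples_mono[OF assms(2)]
  by (fastforce simp: substructure_def is_struct_def restr_def fn_closed_def)

lemma substructure_imp_subset: "substructure L A B \<Longrightarrow> univ A \<subseteq> univ B"
  by (simp add: substructure_def)

lemma substructure_structs: "substructure L A B \<Longrightarrow> is_struct L A" "substructure L A B \<Longrightarrow> is_struct L B"
  by (simp_all add: substructure_def)

lemma substructure_subset:
  assumes "substructure L A C" "substructure L B C" "univ A \<subseteq> univ B"
  shows "substructure L A B"
  using assms tuples_mono[OF assms(3)] unfolding substructure_def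
  by (auto simp: subset_iff)

lemma embedding_substructure: "substructure L A B \<Longrightarrow> embedding L A B (\<lambda>x. x)"
  by (auto simp: embedding_def substructure_def)

lemma isomorphism_imp_embedding: "isomorphism L A B h \<Longrightarrow> embedding L A B h"
  by (simp add: isomorphism_def)

lemma embedding_compose:
  assumes "embedding L A B h" "embedding L B C k"
  shows "embedding L A C (\<lambda>x. k (h x))"
proof -
  have sub: "h ` univ A \<subseteq> univ B" using assms(1) by (simp add: embedding_def)
  have inj: "inj_on (\<lambda>x. k (h x)) (univ A)"
    using assms comp_inj_on[of h "univ A" k] inj_on_subset[OF _ sub, of k]
    by (auto simp: embedding_def comp_def)
  have fn: "k (h (fn A f xs)) = fn C f (map (\<lambda>x. k (h x)) xs)"
    if "f \<in> fsyms L" "xs \<in> tuples (univ A) (farity L f)" for f xs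
    using assms that map_in_tuples[OF that(2) sub]
    by (simp add: embedding_def comp_def)
  have rl: "xs \<in> rel A R \<longleftrightarrow> map (\<lambda>x. k (h x)) xs \<in> rel C R"
    if "R \<in> rsyms L" "xs \<in> tuples (univ A) (rarity L R)" for R xs
    using assms that map_in_tuples[OF that(2) sub]
    by (simp add: embedding_def comp_def)
  have "(\<lambda>x. k (h x)) ` univ A \<subseteq> univ C"
    using assms sub by (simp add: embedding_def image_subset_iff)
  with inj fn rl show ?thesis by (simp add: embedding_def)
qed

lemma isomorphism_compose:
  assumes "isomorphism L A B h" "isomorphism L B C k"
  shows "isomorphism L A C (\<lambda>x. k (h x))"
proof -
  have "(\<lambda>x. k (h x)) ` univ A = k ` (h ` univ A)" by (simp add: image_image)
  then show ?thesis
    using assms embedding_compose[of L A B h C k] unfolding isomorphism_def by simp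
qed

text \<open>Elements of \<open>aut\<close> are extensional, so composites and inverses have to be
  restricted to the universe. The assumption \<open>is_struct L A\<close> keeps the values
  \<open>fn A f xs\<close> where \<open>h\<close> and \<open>k\<close> agree.\<close>

lemma embedding_cong:
  assumes "embedding L A B h" "is_struct L A" "\<And>x. x \<in> univ A \<Longrightarrow> h x = k x"
  shows "embedding L A B k"
proof -
  have im: "h ` univ A = k ` univ A" using assms(3) by (auto simp: image_def)
  have inj: "inj_on k (univ A)" using assms by (simp add: embedding_def inj_on_def)
  have fn: "k (fn A f xs) = fn B f (map k xs)"
    if "f \<in> fsyms L" "xs \<in> tuples (univ A) (farity L f)" for f xs
    using assms(1) that map_cong_tuples[of xs _ _ h k, OF that(2) assms(3)]
      assms(3)[OF fn_in_univ[OF assms(2) that]]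
    by (simp add: embedding_def del: map_eq_conv)
  have rl: "xs \<in> rel A R \<longleftrightarrow> map k xs \<in> rel B R"
    if "R \<in> rsyms L" "xs \<in> tuples (univ A) (rarity L R)" for R xs
    using assms(1) that map_cong_tuples[of xs _ _ h k, OF that(2) assms(3)] by (simp add: embedding_def del: map_eq_conv)
  show ?thesis unfolding embedding_def
    using assms(1) im inj fn rl by (simp add: embedding_def)
qed

lemma isomorphism_cong:
  assumes "isomorphism L A B h" "is_struct L A" "\<And>x. x \<in> univ A \<Longrightarrow> h x = k x"
  shows "isomorphism L A B k"
  using assms embedding_cong[of L A B h k] by (auto simp: isomorphism_def)

lemma isomorphism_inv_into:
  assumes "isomorphism L A B h" "is_struct L A"
  shows "isomorphism L B A (inv_into (univ A) h)"
proof -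
  let ?k = "inv_into (univ A) h"
  have im: "h ` univ A = univ B" and inj: "inj_on h (univ A)" and emb: "embedding L A B h"
    using assms by (auto simp: isomorphism_def embedding_def)
  have kim: "?k ` univ B = univ A" using im inj by (metis inv_into_image_cancel subset_refl)
  have hk: "map h (map ?k xs) = xs" if "xs \<in> tuples (univ B) n" for xs n
    using that im by (auto simp: tuples_def f_inv_into_f intro!: map_idI)
  have mk: "map ?k xs \<in> tuples (univ A) n" if "xs \<in> tuples (univ B) n" for xs n
    using map_in_tuples[OF that, of ?k "univ A"] kim by simp
  have fn: "?k (fn B f xs) = fn A f (map ?k xs)"
    if "f \<in> fsyms L" "xs \<in> tuples (univ B) (farity L f)" for f xs
  proof -
    have "fn B f xs = h (fn A f (map ?k xs))"
      using emb that(1) mk[OF that(2)] hk[OF that(2)] by (simp add: embedding_def)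
    then show ?thesis using inj fn_in_univ[OF assms(2) that(1) mk[OF that(2)]] by simp
  qed
  have rl: "xs \<in> rel B R \<longleftrightarrow> map ?k xs \<in> rel A R"
    if "R \<in> rsyms L" "xs \<in> tuples (univ B) (rarity L R)" for R xs
    using emb that(1) mk[OF that(2)] hk[OF that(2)] by (simp add: embedding_def)
  have "inj_on ?k (univ B)" using im by (metis inj_on_inv_into subset_refl)
  then show ?thesis using kim fn rl by (auto simp: isomorphism_def embedding_def)
qed

text \<open>The image is closed under the functions of \<open>M\<close> because \<open>h\<close>
  commutes with them. This turns embeddings into isomorphisms between substructures, the form in
  which homogeneity is stated.\<close>

lemma isomorphism_onto_image:
  assumes "is_struct L A" "is_struct L M" "embedding L A M h"
  shows "substructure L (restr L M (h ` univ A)) M" "isomorphism L A (restr L M (h ` univ A)) h"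
proof -
  have tup: "\<exists>ys\<in>tuples (univ A) n. xs = map h ys" if "xs \<in> tuples (h ` univ A) n" for xs n
  proof
    let ?ys = "map (inv_into (univ A) h) xs"
    show "?ys \<in> tuples (univ A) n"
      using that by (auto simp: tuples_def intro!: inv_into_into)
    show "xs = map h ?ys"
      using that by (auto simp: tuples_def f_inv_into_f intro!: map_idI[symmetric])
  qed
  have cl: "fn_closed L M (h ` univ A)"
    unfolding fn_closed_def
  proof (intro ballI)
    fix f xs assume f: "f \<in> fsyms L" and "xs \<in> tuples (h ` univ A) (farity L f)"
    then obtain ys where ys: "ys \<in> tuples (univ A) (farity L f)" "xs = map h ys" using tup by blast
    then have "fn M f xs = h (fn A f ys)" using assms(3) f by (simp add: embedding_def)
    then show "fn M f xs \<in> h ` univ A" using fn_in_univ[OF assms(1) f ys(1)] by simp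
  qed
  show sub: "substructure L (restr L M (h ` univ A)) M"
    using substructure_restr[OF assms(2) _ cl] assms(3) by (simp add: embedding_def)
  show "isomorphism L A (restr L M (h ` univ A)) h"
    using assms(3) map_in_tuples[where h=h and S="univ A" and T="h ` univ A"]
    by (auto simp: isomorphism_def embedding_def restr_def)
qed

section \<open>Automorphisms under composition and inversion\<close>

lemma aut_isomorphism: "g \<in> aut L M \<Longrightarrow> isomorphism L M M g"
  by (simp add: aut_def)

lemma aut_embedding: "g \<in> aut L M \<Longrightarrow> embedding L M M g"
  by (simp add: aut_def isomorphism_def)

lemma aut_image: "g \<in> aut L M \<Longrightarrow> g ` univ M = univ M"
  by (simp add: aut_def isomorphism_def)

lemma aut_inj: "g \<in> aut L M \<Longrightarrow> inj_on g (univ M)"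
  by (simp add: aut_def isomorphism_def embedding_def)

lemma aut_apply: "g \<in> aut L M \<Longrightarrow> x \<in> univ M \<Longrightarrow> g x \<in> univ M"
  using aut_image by blast

lemma restrict_in_aut:
  "isomorphism L M M g \<Longrightarrow> is_struct L M \<Longrightarrow> restrict g (univ M) \<in> aut L M"
  unfolding aut_def using isomorphism_cong[of L M M g "restrict g (univ M)"] by simp

lemma aut_id: "is_struct L M \<Longrightarrow> (\<lambda>x\<in>univ M. x) \<in> aut L M"
  by (intro restrict_in_aut) (auto simp: isomorphism_def embedding_def)

lemma aut_compose:
  "g \<in> aut L M \<Longrightarrow> h \<in> aut L M \<Longrightarrow> is_struct L M \<Longrightarrow> compose (univ M) g h \<in> aut L M"
  unfolding compose_def
  by (rule restrict_in_aut[OF isomorphism_compose[OF aut_isomorphism aut_isomorphism]])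

lemma aut_inv_into:
  "g \<in> aut L M \<Longrightarrow> is_struct L M \<Longrightarrow> restrict (inv_into (univ M) g) (univ M) \<in> aut L M"
  by (rule restrict_in_aut[OF isomorphism_inv_into[OF aut_isomorphism]])

section \<open>Generated substructures, transport of structure, homogeneity and rigidity\<close>

lemma fn_closed_generated: "fn_closed L M (generated_univ L M S)"
proof -
  have "tuples (generated_univ L M S) n \<subseteq> tuples T n"
    if "S \<subseteq> T" "T \<subseteq> univ M" "\<forall>f\<in>fsyms L. \<forall>xs\<in>tuples T (farity L f). fn M f xs \<in> T" for T n
    using that by (intro tuples_mono) (auto simp: generated_univ_def)
  then show ?thesis unfolding fn_closed_def
    by (subst (2) generated_univ_def) blast
qed

lemma generated_superset: "S \<subseteq> generated_univ L M S"
  by (auto simp: generated_univ_def)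

lemma generated_subset_univ: "is_struct L M \<Longrightarrow> S \<subseteq> univ M \<Longrightarrow> generated_univ L M S \<subseteq> univ M"
  unfolding generated_univ_def using fn_in_univ by (intro Inter_lower) auto

lemma generated_substructure:
  assumes "is_struct L M" "locally_finite L M" "finite S" "S \<subseteq> univ M"
  shows "substructure L (restr L M (generated_univ L M S)) M" "finite (generated_univ L M S)"
  using assms substructure_restr[OF assms(1) generated_subset_univ[OF assms(1,4)] fn_closed_generated]
  by (auto simp: locally_finite_def)

text \<open>Transport of structure along an injection. It is needed because \<open>age\<close>
  contains only structures on natural numbers, whereas substructures of \<open>M\<close> live on the
  type of \<open>M\<close>.\<close>

lemma pushforward_struct:
  assumes B: "is_struct L B" and inj: "inj_on e (univ B)"
  obtains B0 where "is_struct L B0" "isomorphism L B B0 e"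
proof -
  let ?k = "inv_into (univ B) e"
  define B0 where "B0 = \<lparr>univ = e ` univ B,
    fn = (\<lambda>f. if f \<in> fsyms L then \<lambda>xs\<in>tuples (e ` univ B) (farity L f). e (fn B f (map ?k xs))
               else (\<lambda>_. undefined)),
    rel = (\<lambda>R. if R \<in> rsyms L then map e ` rel B R else {})\<rparr>"
  have kk: "map ?k xs \<in> tuples (univ B) n" if "xs \<in> tuples (e ` univ B) n" for xs n
    using that by (auto simp: tuples_def intro!: inv_into_into)
  have ke: "map ?k (map e xs) = xs" if "xs \<in> tuples (univ B) n" for xs n
    using that inj by (auto simp: tuples_def intro!: map_idI)
  have em: "map e xs \<in> tuples (e ` univ B) n" if "xs \<in> tuples (univ B) n" for xs n
    using that map_in_tuples by blast
  have 1: "is_struct L B0"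
    using kk em fn_in_univ[OF B] rel_subset_tuples[OF B]
    by (auto simp: is_struct_def B0_def image_subset_iff subset_iff)
  have rl: "xs \<in> rel B R \<longleftrightarrow> map e xs \<in> map e ` rel B R"
    if "R \<in> rsyms L" "xs \<in> tuples (univ B) (rarity L R)" for R xs
  proof
    assume "map e xs \<in> map e ` rel B R"
    then obtain ys where ys: "ys \<in> rel B R" "map e xs = map e ys" by blast
    then have "ys \<in> tuples (univ B) (rarity L R)" using rel_subset_tuples[OF B that(1)] by blast
    from ke[OF this] have "xs = ys" unfolding ys(2)[symmetric] using ke[OF that(2)] by simp
    then show "xs \<in> rel B R" using ys(1) by simp
  qed simp
  have 2: "isomorphism L B B0 e"
    using inj ke em rl by (auto simp: isomorphism_def embedding_def B0_def simp del: map_map)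
  show thesis using that 1 2 .
qed

text \<open>Conjugation by \<open>e\<close> turns an automorphism of \<open>A\<close> into one of
  \<open>B\<close>. Rigidity of members of \<open>age\<close> is carried back in this way to
  substructures of \<open>M\<close>.\<close>

lemma rigid_isomorphism:
  assumes iso: "isomorphism L A B e" and A: "is_struct L A" and B: "is_struct L B" and "rigid L B"
  shows "rigid L A"
  unfolding rigid_def
proof (intro ballI)
  fix g x assume g: "g \<in> aut L A" and x: "x \<in> univ A"
  let ?k = "inv_into (univ A) e"
  have "isomorphism L B B (\<lambda>y. e (g (?k y)))"
    using isomorphism_compose[OF isomorphism_compose[OF isomorphism_inv_into[OF iso A] aut_isomorphism[OF g]] iso]
    by simp
  from restrict_in_aut[OF this B] have "e (g (?k y)) = y" if "y \<in> univ B" for y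
    using assms(4) that by (auto simp: rigid_def)
  moreover have inj: "inj_on e (univ A)" and ex: "e x \<in> univ B" using iso x
    by (auto simp: isomorphism_def embedding_def)
  ultimately have "e (g x) = e x" using x by (metis inv_into_f_f)
  then show "g x = x" using inj aut_apply[OF g x] x by (auto dest: inj_onD)
qed

text \<open>Homogeneity speaks of isomorphisms between finite substructures; replacing the target by
  the image of \<open>h\<close> brings the embedding into that form.\<close>

lemma fraisse_extend_embedding:
  assumes "fraisse_structure L M" "substructure L A M" "finite (univ A)" "embedding L A M h"
  obtains g where "g \<in> aut L M" "\<And>x. x \<in> univ A \<Longrightarrow> g x = h x"
proof -
  note onto = isomorphism_onto_image[OF substructure_structs[OF assms(2)] assms(4)]
  have "finite (univ (restr L M (h ` univ A)))" using assms(3) by simp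
  then have "\<exists>g\<in>aut L M. \<forall>x\<in>univ A. g x = h x"
    using assms(1-3) onto unfolding fraisse_structure_def by blast
  then show thesis using that by blast
qed

text \<open>On \<open>univ A\<close>, the inverse of \<open>g\<close> after \<open>g'\<close> is an
  automorphism of \<open>A\<close>, hence the identity. So the image of \<open>A\<close> determines
  the restriction of \<open>g\<close> to \<open>A\<close>, and a colouring of such restrictions is a
  colouring of copies of \<open>A\<close>.\<close>

lemma rigid_aut_eq:
  assumes A: "substructure L A M" and rigid: "rigid L A"
    and g: "g \<in> aut L M" and g': "g' \<in> aut L M" and im: "g ` univ A = g' ` univ A" and x: "x \<in> univ A"
  shows "g x = g' x"
proof -
  note st = substructure_structs[OF A]
  have emb: "isomorphism L A (restr L M (k ` univ A)) k" if "k \<in> aut L M" for k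
    using isomorphism_onto_image(2)[OF st embedding_compose[OF embedding_substructure[OF A] aut_embedding[OF that]]] .
  let ?k = "\<lambda>x. inv_into (univ A) g (g' x)"
  have "isomorphism L A A ?k"
    using isomorphism_compose[OF emb[OF g', folded im] isomorphism_inv_into[OF emb[OF g] st(1)]] .
  from restrict_in_aut[OF this st(1)] have "?k x = x" using rigid x by (auto simp: rigid_def)
  moreover have "g' x \<in> g ` univ A" using im x by simp
  ultimately show ?thesis by (metis f_inv_into_f)
qed

subsection \<open>The Ramsey property for the automorphism group\<close>

lemma ramsey_class_substructure:
  assumes "ramsey_class L K" "B \<in> K" "substructure L A B"
  shows "A \<in> K"
proof -
  have "\<forall>B\<in>K. \<forall>A. substructure L A B \<longrightarrow> A \<in> K"
    using assms(1) unfolding ramsey_class_def by (elim conjE)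
  with assms(2,3) show ?thesis by blast
qed

lemma ramsey_class_partition:
  fixes k :: nat
  assumes "ramsey_class L K" "B \<in> K" "substructure L A B"
  obtains C where "C \<in> K" "substructure L B C"
    "\<forall>col\<in>copies L C A \<rightarrow> {..<k}. \<exists>B'\<in>copies L C B. \<exists>i. \<forall>A'\<in>copies L B' A. col A' = i"
proof -
  have "\<forall>k::nat. \<forall>A B. B \<in> K \<and> substructure L A B \<longrightarrow>
        (\<exists>C\<in>K. substructure L B C \<and>
          (\<forall>col\<in>(copies L C A \<rightarrow> {..<k}).
             \<exists>B'\<in>copies L C B. \<exists>i. \<forall>A'\<in>copies L B' A. col A' = i))"
    using assms(1) unfolding ramsey_class_def by (elim conjE)
  from this[rule_format, of B A k] assms(2,3) obtain C where "C \<in> K" "substructure L B C"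
    "\<forall>col\<in>(copies L C A \<rightarrow> {..<k}). \<exists>B'\<in>copies L C B. \<exists>i. \<forall>A'\<in>copies L B' A. col A' = i"
    by auto
  then show thesis using that by simp
qed

text \<open>A finitary form of the extreme amenability of the automorphism group. By rigidity,
  \<open>\<phi>\<close> induces a colouring of the copies of the substructure \<open>A\<close>
  generated by \<open>S\<close>. Let a finite \<open>B\<close> contain \<open>A\<close> and its
  translates under \<open>H\<close>; a monochromatic copy of \<open>B\<close>, moved into
  \<open>M\<close>, is the image of \<open>B\<close> under the desired \<open>g\<close>.\<close>

lemma ramsey_aut:
  fixes L :: "('f, 'r) lang" and M :: "('a, 'f, 'r) struct" and \<phi> :: "('a \<Rightarrow> 'a) \<Rightarrow> 'c"
  assumes M: "is_struct L M" and R: "ramsey_structure L M"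
    and S: "finite S" "S \<subseteq> univ M" and H: "finite H" "H \<subseteq> aut L M"
    and fin: "finite (\<phi> ` aut L M)"
    and dep: "\<And>g g'. g \<in> aut L M \<Longrightarrow> g' \<in> aut L M \<Longrightarrow> (\<And>x. x \<in> S \<Longrightarrow> g x = g' x) \<Longrightarrow> \<phi> g = \<phi> g'"
  shows "\<exists>g\<in>aut L M. \<forall>h\<in>H. \<phi> (compose (univ M) g h) = \<phi> g"
proof -
  have fr: "fraisse_structure L M" and lf: "locally_finite L M" and rc: "ramsey_class L (age L M)"
    and rig: "\<And>A. A \<in> age L M \<Longrightarrow> rigid L A"
    using R by (auto simp: ramsey_structure_def fraisse_structure_def)
  define A where "A = restr L M (generated_univ L M S)"
  have A: "substructure L A M" "finite (univ A)" and SA: "S \<subseteq> univ A"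
    using generated_substructure[OF M lf S] generated_superset[of S L M] by (auto simp: A_def)
  \<comment> \<open>\<open>T\<close> collects \<open>A\<close> and its translates under
    \<open>H\<close>, so that all of them lie in \<open>B\<close>.\<close>
  define T where "T = univ A \<union> (\<Union>h\<in>H. h ` univ A)"
  have T: "finite T" "T \<subseteq> univ M"
  proof -
    show "finite T" using A(2) H(1) by (simp add: T_def)
    have "h x \<in> univ M" if "h \<in> H" "x \<in> univ A" for h x
      using that H(2) substructure_imp_subset[OF A(1)] by (intro aut_apply[of h L]) auto
    then show "T \<subseteq> univ M" using substructure_imp_subset[OF A(1)] by (auto simp: T_def)
  qed
  define B where "B = restr L M (generated_univ L M T)"
  have B: "substructure L B M" "finite (univ B)" and TB: "T \<subseteq> univ B"
    using generated_substructure[OF M lf T] generated_superset[of T L M] by (auto simp: B_def)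
  have AB: "substructure L A B" using substructure_subset[OF A(1) B(1)] TB by (auto simp: T_def)
  note stA = substructure_structs(1)[OF A(1)] and stB = substructure_structs(1)[OF B(1)]
  obtain e :: "'a \<Rightarrow> nat" where e: "inj_on e (univ B)"
    using finite_imp_inj_to_nat_seg[OF B(2)] by blast
  obtain B0 where B0: "is_struct L B0" "isomorphism L B B0 e"
    using pushforward_struct[OF stB e] .
  have B0K: "B0 \<in> age L M"
    using B0 B(2) embedding_compose[OF isomorphism_imp_embedding[OF isomorphism_inv_into[OF B0(2) stB]]
        embedding_substructure[OF B(1)]]
    by (auto simp: age_def isomorphism_def) (metis finite_imageI)
  define A0 where "A0 = restr L B0 (e ` univ A)"
  have A0: "substructure L A0 B0" "isomorphism L A A0 e"
    using isomorphism_onto_image[OF stA B0(1)] embedding_compose[OF embedding_substructure[OF AB]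
        isomorphism_imp_embedding[OF B0(2)]] by (auto simp: A0_def)
  note stA0 = substructure_structs(1)[OF A0(1)]
  have "A0 \<in> age L M" using ramsey_class_substructure[OF rc B0K A0(1)] .
  then have rigA: "rigid L A" using rigid_isomorphism[OF A0(2) stA stA0] rig by blast
  have eqA: "\<phi> g = \<phi> g'" if "g \<in> aut L M" "g' \<in> aut L M" "g ` univ A = g' ` univ A" for g g'
    using rigid_aut_eq[OF A(1) rigA that] SA that by (intro dep) auto
  obtain enc :: "'c \<Rightarrow> nat" and k where enc: "enc ` (\<phi> ` aut L M) = {i. i < k}" "inj_on enc (\<phi> ` aut L M)"
    using finite_imp_inj_to_nat_seg[OF fin] by blast
  obtain C where C: "C \<in> age L M" "substructure L B0 C"
    and ram: "\<forall>col\<in>copies L C A0 \<rightarrow> {..<k}. \<exists>B'\<in>copies L C B0. \<exists>i. \<forall>A'\<in>copies L B' A0. col A' = i"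
    by (rule ramsey_class_partition[OF rc B0K A0(1), of k])
  from C obtain \<iota> where \<iota>: "embedding L C M \<iota>" and stC: "is_struct L C"
    by (auto simp: age_def)
  \<comment> \<open>Through \<open>\<iota>\<close>, a copy of \<open>A\<close> in \<open>C\<close>
    becomes a copy in \<open>M\<close>. By homogeneity it is the image of \<open>A\<close> under an
    automorphism, and by \<open>eqA\<close> the colour does not depend on which one is
    chosen.\<close>
  define col where "col A' = enc (\<phi> (SOME g. g \<in> aut L M \<and> g ` univ A = \<iota> ` univ A'))"
    for A' :: "(nat, 'f, 'r) struct"
  have colI: "col A' = enc (\<phi> g)" if "g \<in> aut L M" "g ` univ A = \<iota> ` univ A'" for A' g
  proof -
    let ?P = "\<lambda>g. g \<in> aut L M \<and> g ` univ A = \<iota> ` univ A'"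
    have "?P (SOME g. ?P g)" using that by (intro someI[of ?P g]) simp
    then have "\<phi> (SOME g. ?P g) = \<phi> g" using that by (intro eqA) simp_all
    then show ?thesis by (simp add: col_def)
  qed
  have "col A' \<in> {..<k}" if "A' \<in> copies L C A0" for A'
  proof -
    obtain \<sigma> where A': "substructure L A' C" and \<sigma>: "isomorphism L A' A0 \<sigma>"
      using \<open>A' \<in> copies L C A0\<close> by (auto simp: copies_def isomorphic_def)
    note st = substructure_structs(1)[OF A']
    have iso: "isomorphism L A A' (\<lambda>x. inv_into (univ A') \<sigma> (e x))"
      using isomorphism_compose[OF A0(2) isomorphism_inv_into[OF \<sigma> st]] .
    obtain g where g: "g \<in> aut L M" "\<And>x. x \<in> univ A \<Longrightarrow> g x = \<iota> (inv_into (univ A') \<sigma> (e x))"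
      using fraisse_extend_embedding[OF fr A embedding_compose[OF isomorphism_imp_embedding[OF iso]
            embedding_compose[OF embedding_substructure[OF A'] \<iota>]]] by blast
    have "g ` univ A = \<iota> ` ((\<lambda>x. inv_into (univ A') \<sigma> (e x)) ` univ A)"
      using g(2) by (simp add: image_image)
    then have "g ` univ A = \<iota> ` univ A'" using iso by (simp add: isomorphism_def)
    from colI[OF g(1) this] show ?thesis using enc(1) g(1) by auto
  qed
  then have "col \<in> copies L C A0 \<rightarrow> {..<k}" by (rule Pi_I)
  from ram[rule_format, OF this] obtain B' i
    where B': "B' \<in> copies L C B0" and i: "\<And>A'. A' \<in> copies L B' A0 \<Longrightarrow> col A' = i"
    by auto
  from B' obtain \<sigma> where B'C: "substructure L B' C" and \<sigma>: "isomorphism L B' B0 \<sigma>"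
    by (auto simp: copies_def isomorphic_def)
  note stB' = substructure_structs(1)[OF B'C]
  define \<beta> where "\<beta> = (\<lambda>x. inv_into (univ B') \<sigma> (e x))"
  have \<beta>: "isomorphism L B B' \<beta>"
    using isomorphism_compose[OF B0(2) isomorphism_inv_into[OF \<sigma> stB']] by (simp add: \<beta>_def)
  have \<beta>C: "embedding L B C \<beta>"
    using embedding_compose[OF isomorphism_imp_embedding[OF \<beta>] embedding_substructure[OF B'C]] .
  \<comment> \<open>\<open>g\<close> carries \<open>B\<close> onto the monochromatic copy of
    \<open>B\<close>, seen inside \<open>M\<close>.\<close>
  obtain g where g: "g \<in> aut L M" "\<And>x. x \<in> univ B \<Longrightarrow> g x = \<iota> (\<beta> x)"
    using fraisse_extend_embedding[OF fr B embedding_compose[OF \<beta>C \<iota>]] by blast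
  have main: "enc (\<phi> (compose (univ M) g h)) = i" if h: "h \<in> aut L M" and hA: "h ` univ A \<subseteq> univ B" for h
  proof -
    have hM: "embedding L A M h"
      using embedding_compose[OF embedding_substructure[OF A(1)] aut_embedding[OF h]] .
    have "substructure L (restr L M (h ` univ A)) B"
      using substructure_subset[OF isomorphism_onto_image(1)[OF stA M hM] B(1)] hA by simp
    then have hB: "embedding L A B h"
      using embedding_compose[OF isomorphism_imp_embedding[OF isomorphism_onto_image(2)[OF stA M hM]]
          embedding_substructure] by simp
    define A' where "A' = restr L C ((\<lambda>x. \<beta> (h x)) ` univ A)"
    have A'C: "substructure L A' C" and iso: "isomorphism L A A' (\<lambda>x. \<beta> (h x))"
      using isomorphism_onto_image[OF stA stC embedding_compose[OF hB \<beta>C]] by (simp_all add: A'_def)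
    have "univ A' \<subseteq> univ B'" using \<beta> hA by (auto simp: A'_def isomorphism_def)
    then have "substructure L A' B'" using substructure_subset[OF A'C B'C] by blast
    moreover have "isomorphic L A' A0"
      using isomorphism_compose[OF isomorphism_inv_into[OF iso stA] A0(2)] unfolding isomorphic_def by blast
    ultimately have "col A' = i" by (intro i) (simp add: copies_def)
    moreover have "compose (univ M) g h ` univ A = \<iota> ` univ A'"
    proof -
      have "compose (univ M) g h x = \<iota> (\<beta> (h x))" if "x \<in> univ A" for x
        using that g(2) hA substructure_imp_subset[OF A(1)] by (auto simp: compose_def)
      then show ?thesis by (simp add: A'_def image_image)
    qed
    ultimately show ?thesis using colI[OF aut_compose[OF g(1) h M]] by simp
  qed
  \<comment> \<open>The identity also maps \<open>A\<close> into \<open>B\<close>, so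
    \<open>main\<close> applies to it and gives \<open>g\<close> itself the common colour.\<close>
  have "compose (univ M) g (\<lambda>x\<in>univ M. x) = g"
    using g(1) by (auto simp: compose_def aut_def extensional_def)
  then have gi: "enc (\<phi> g) = i"
    using main[OF aut_id[OF M]] substructure_imp_subset[OF AB] substructure_imp_subset[OF A(1)]
    by (auto simp: image_subset_iff subset_iff)
  show ?thesis
  proof (intro bexI[OF _ g(1)] ballI)
    fix h assume h: "h \<in> H"
    then have hM: "h \<in> aut L M" using H(2) by blast
    have "h ` univ A \<subseteq> T" using h by (auto simp: T_def)
    then have "h ` univ A \<subseteq> univ B" using TB by (rule subset_trans)
    with main[OF hM] gi have "enc (\<phi> (compose (univ M) g h)) = enc (\<phi> g)" by simp
    then show "\<phi> (compose (univ M) g h) = \<phi> g"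
      using aut_compose[OF g(1) hM M] g(1) by (intro inj_onD[OF enc(2)]) simp_all
  qed
qed

text \<open>
  Translating by a representative of the coset of the stabiliser transports the
  Ramsey property from the full group to the stabiliser.
\<close>

lemma ramsey_pt_stab:
  fixes L :: "('f, 'r) lang" and M :: "('a, 'f, 'r) struct" and \<phi> :: "('a \<Rightarrow> 'a) \<Rightarrow> 'c"
  assumes M: "is_struct L M" and R: "ramsey_structure L M"
    and C: "finite C" "C \<subseteq> univ M"
    and S: "finite S" "S \<subseteq> univ M" and H: "finite H" "H \<subseteq> pt_stab L M C"
    and fin: "finite (\<phi> ` pt_stab L M C)"
    and dep: "\<And>g g'. g \<in> pt_stab L M C \<Longrightarrow> g' \<in> pt_stab L M C \<Longrightarrow> (\<And>x. x \<in> S \<Longrightarrow> g x = g' x) \<Longrightarrow> \<phi> g = \<phi> g'"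
  shows "\<exists>g\<in>pt_stab L M C. \<forall>h\<in>H. \<phi> (compose (univ M) g h) = \<phi> g"
proof -
  \<comment> \<open>\<open>s g\<close> represents the coset of \<open>g\<close> modulo the
    stabiliser of \<open>C\<close>. It is chosen from the values of \<open>g\<close> on
    \<open>C\<close> alone, so automorphisms that agree on \<open>C\<close> get the same
    representative.\<close>
  define s where "s g = (SOME s. s \<in> aut L M \<and> (\<forall>x\<in>C. s x = g x))" for g
  have s: "s g \<in> aut L M" "\<And>x. x \<in> C \<Longrightarrow> s g x = g x" if "g \<in> aut L M" for g
    using someI[of "\<lambda>s. s \<in> aut L M \<and> (\<forall>x\<in>C. s x = g x)" g] that by (auto simp: s_def)
  have seq: "s g = s g'" if "\<And>x. x \<in> C \<Longrightarrow> g x = g' x" for g g'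
    using that by (simp add: s_def cong: conj_cong)
  \<comment> \<open>Dividing out the representative on the left leaves an automorphism that fixes
    \<open>C\<close> pointwise.\<close>
  define t where "t g = compose (univ M) (restrict (inv_into (univ M) (s g)) (univ M)) g" for g
  have t: "t g \<in> pt_stab L M C" if g: "g \<in> aut L M" for g
  proof -
    have "t g x = x" if "x \<in> C" for x
    proof -
      have "t g x = inv_into (univ M) (s g) (s g x)"
        using that C aut_apply[OF g] s(2)[OF g that] by (auto simp: t_def compose_def)
      then show ?thesis using aut_inj[OF s(1)[OF g]] that C by auto
    qed
    then show ?thesis using aut_compose[OF aut_inv_into[OF s(1)[OF g] M] g M]
      by (auto simp: pt_stab_def t_def)
  qed
  have "\<exists>g\<in>aut L M. \<forall>h\<in>H. \<phi> (t (compose (univ M) g h)) = \<phi> (t g)"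
  \<comment> \<open>\<open>C\<close> joins \<open>S\<close> because \<open>t g\<close> depends on
    \<open>g\<close> also through its representative.\<close>
  proof (rule ramsey_aut[OF M R, where S = "S \<union> C"])
    show "finite ((\<lambda>g. \<phi> (t g)) ` aut L M)"
      by (rule finite_subset[OF _ fin]) (use t in auto)
    show "\<phi> (t g) = \<phi> (t g')" if "g \<in> aut L M" "g' \<in> aut L M" "\<And>x. x \<in> S \<union> C \<Longrightarrow> g x = g' x" for g g'
    proof (rule dep)
      show "t g x = t g' x" if "x \<in> S" for x
        using seq[of g g'] \<open>\<And>x. x \<in> S \<union> C \<Longrightarrow> g x = g' x\<close> that S by (auto simp: t_def compose_def)
    qed (use t that in auto)
  qed (use C S H in \<open>auto simp: pt_stab_def\<close>)
  then obtain g where g: "g \<in> aut L M" and *: "\<And>h. h \<in> H \<Longrightarrow> \<phi> (t (compose (univ M) g h)) = \<phi> (t g)"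
    by blast
  have "t (compose (univ M) g h) = compose (univ M) (t g) h" if "h \<in> H" for h
  proof -
    have h: "h \<in> aut L M" "\<And>x. x \<in> C \<Longrightarrow> h x = x" using that H by (auto simp: pt_stab_def)
    \<comment> \<open>Composing with \<open>h\<close> on the right does not change the values on
      \<open>C\<close>. The representative is therefore the same, and \<open>t\<close> commutes with
      right multiplication by \<open>h\<close>.\<close>
    have sgh: "s (compose (univ M) g h) = s g" using h(2) C by (intro seq) (auto simp: compose_def)
    show ?thesis unfolding t_def sgh using aut_apply[OF h(1)] aut_apply[OF g]
      by (simp add: compose_def fun_eq_iff)
  qed
  then show ?thesis using * t[OF g] by (intro bexI[of _ "t g"]) auto
qed

subsection \<open>Finite colourings of a field\<close>

text \<open>This is the graph of a homomorphism from an additive subgroup of the field to the circle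
  \<open>\<real>\<close> modulo \<open>\<int>\<close>, sending \<open>1\<close> to the class of
  \<open>c\<close>. Every fibre is a full coset of the integers; the last clause fixes the fibre at
  \<open>0\<close>, and with closure under differences this makes the homomorphism well
  defined.\<close>

definition partial_character :: "real \<Rightarrow> ('k::field \<times> real) set \<Rightarrow> bool" where
  "partial_character c \<Gamma> \<longleftrightarrow> (1, c) \<in> \<Gamma> \<and>
     (\<forall>x y x' y'. (x, y) \<in> \<Gamma> \<longrightarrow> (x', y') \<in> \<Gamma> \<longrightarrow> (x - x', y - y') \<in> \<Gamma>) \<and>
     (\<forall>s. (0, s) \<in> \<Gamma> \<longleftrightarrow> s \<in> \<int>)"

lemma partial_character_diff:
  "partial_character c \<Gamma> \<Longrightarrow> (x, y) \<in> \<Gamma> \<Longrightarrow> (x', y') \<in> \<Gamma> \<Longrightarrow> (x - x', y - y') \<in> \<Gamma>"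
  by (simp add: partial_character_def)

lemma partial_character_zero: "partial_character c \<Gamma> \<Longrightarrow> (0, s) \<in> \<Gamma> \<longleftrightarrow> s \<in> \<int>"
  by (simp add: partial_character_def)

lemma partial_character_uminus:
  "partial_character c \<Gamma> \<Longrightarrow> (x, y) \<in> \<Gamma> \<Longrightarrow> (- x, - y) \<in> \<Gamma>"
  using partial_character_diff[of c \<Gamma> 0 0 x y] by (simp add: partial_character_zero)

lemma partial_character_add:
  "partial_character c \<Gamma> \<Longrightarrow> (x, y) \<in> \<Gamma> \<Longrightarrow> (x', y') \<in> \<Gamma> \<Longrightarrow> (x + x', y + y') \<in> \<Gamma>"
  using partial_character_diff[of c \<Gamma> x y "- x'" "- y'"] by (simp add: partial_character_uminus)

lemma partial_character_mult_of_int: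
  assumes "partial_character c \<Gamma>" "(x, y) \<in> \<Gamma>"
  shows "(of_int m * x, of_int m * y) \<in> \<Gamma>"
proof (induction m rule: int_induct[of _ 0])
  case base
  show ?case using assms(1) by (simp add: partial_character_zero)
next
  case (step1 i)
  then show ?case using partial_character_add[OF assms(1) step1(2) assms(2)] by (simp add: algebra_simps)
next
  case (step2 i)
  then show ?case using partial_character_diff[OF assms(1) step2(2) assms(2)] by (simp add: algebra_simps)
qed

text \<open>
  The value of an extension at \<open>x\<close> is forced up to division by the order \<open>d\<close> of \<open>x\<close> modulo
  the domain; divisibility of the reals provides it.
\<close>

lemma partial_character_extend:
  fixes x :: "'k::field"
  assumes \<Gamma>: "partial_character c \<Gamma>"
  obtains \<Gamma>' y where "partial_character c \<Gamma>'" "\<Gamma> \<subseteq> \<Gamma>'" "(x, y) \<in> \<Gamma>'"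
proof -
  \<comment> \<open>\<open>D\<close> is the ideal of those integers \<open>n\<close> for which
    \<open>n x\<close> lies in the domain.\<close>
  define D where "D = {n::int. \<exists>t. (of_int n * x, t) \<in> \<Gamma>}"
  have D_mult: "m * n \<in> D" if "n \<in> D" for m n
    using that partial_character_mult_of_int[OF \<Gamma>, of "of_int n * x" _ m]
    by (auto simp: D_def mult.assoc)
  have D_diff: "m - n \<in> D" if "m \<in> D" "n \<in> D" for m n
    using that partial_character_diff[OF \<Gamma>] by (fastforce simp: D_def left_diff_distrib)
  have "\<exists>d y. (of_int d * x, of_int d * y) \<in> \<Gamma> \<and> (\<forall>n\<in>D. d dvd n)"
  proof (cases "\<exists>n\<in>D. n \<noteq> 0")
    case False
    \<comment> \<open>No nonzero integer is in \<open>D\<close>, so \<open>d = 0\<close> divides all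
      its elements and any \<open>y\<close> will do.\<close>
    then show ?thesis using \<Gamma> by (intro exI[of _ 0]) (auto simp: partial_character_zero)
  next
    case True
    then obtain n where n: "n \<in> D" "n \<noteq> 0" by blast
    have "\<bar>n\<bar> \<in> D" using D_mult[OF n(1), of "sgn n"] by (simp add: abs_sgn mult.commute)
    then have ex: "int (nat \<bar>n\<bar>) \<in> D \<and> 0 < nat \<bar>n\<bar>" using n by simp
    define k where "k = (LEAST k. int k \<in> D \<and> 0 < k)"
    have k: "int k \<in> D" "0 < k" using LeastI[of "\<lambda>k. int k \<in> D \<and> 0 < k", OF ex] by (auto simp: k_def)
    have dvd: "int k dvd m" if "m \<in> D" for m
    proof (rule ccontr)
      assume "\<not> int k dvd m"
      then have "m mod int k \<noteq> 0" by (simp add: dvd_eq_mod_eq_0)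
      moreover have "0 \<le> m mod int k" using k(2) by simp
      ultimately have pos: "0 < m mod int k" by linarith
      have "m mod int k = m - (m div int k) * int k" by (simp add: minus_div_mult_eq_mod)
      then have "m mod int k \<in> D" using D_diff[OF that D_mult[OF k(1)]] by simp
      then have "int (nat (m mod int k)) \<in> D \<and> 0 < nat (m mod int k)" using pos by simp
      then have "k \<le> nat (m mod int k)"
        using Least_le[of "\<lambda>k. int k \<in> D \<and> 0 < k"] by (simp only: k_def[symmetric])
      moreover have "m mod int k < int k" using k(2) by simp
      ultimately show False using pos by linarith
    qed
    obtain t where "(of_int (int k) * x, t) \<in> \<Gamma>" using k(1) by (auto simp: D_def)
    then have "(of_int (int k) * x, of_int (int k) * (t / of_int (int k))) \<in> \<Gamma>"
      using k(2) by simp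
    then show ?thesis using dvd by blast
  qed
  then obtain d y where d: "(of_int d * x, of_int d * y) \<in> \<Gamma>" "\<And>n. n \<in> D \<Longrightarrow> d dvd n" by blast
  define \<Gamma>' where "\<Gamma>' = {(a + of_int m * x, b + of_int m * y) | a b m. (a, b) \<in> \<Gamma>}"
  have \<Gamma>'I: "(a + of_int m * x, b + of_int m * y) \<in> \<Gamma>'" if "(a, b) \<in> \<Gamma>" for a b m
    using that unfolding \<Gamma>'_def by blast
  have sub: "\<Gamma> \<subseteq> \<Gamma>'"
    using \<Gamma>'I[of _ _ 0] by (intro subrelI) simp
  have xy: "(x, y) \<in> \<Gamma>'"
    using \<Gamma>'I[of 0 0 1] partial_character_zero[OF \<Gamma>, of 0] by simp
  have diff: "(a - a', b - b') \<in> \<Gamma>'" if ab: "(a, b) \<in> \<Gamma>'" and ab': "(a', b') \<in> \<Gamma>'" for a b a' b'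
  proof -
    from ab obtain a1 b1 m where 1: "(a1, b1) \<in> \<Gamma>" "a = a1 + of_int m * x" "b = b1 + of_int m * y"
      by (auto simp: \<Gamma>'_def)
    from ab' obtain a2 b2 n where 2: "(a2, b2) \<in> \<Gamma>" "a' = a2 + of_int n * x" "b' = b2 + of_int n * y"
      by (auto simp: \<Gamma>'_def)
    have "(a1 - a2, b1 - b2) \<in> \<Gamma>" using partial_character_diff[OF \<Gamma> 1(1) 2(1)] .
    moreover have "a - a' = (a1 - a2) + of_int (m - n) * x" "b - b' = (b1 - b2) + of_int (m - n) * y"
      using 1 2 by (simp_all add: algebra_simps)
    ultimately show ?thesis using \<Gamma>'I by (simp only:)
  qed
  \<comment> \<open>Well-definedness: if \<open>a + m x = 0\<close>, then \<open>d\<close> divides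
    \<open>m\<close>, and the choice of \<open>y\<close> makes \<open>m y\<close> a value of
    \<open>\<Gamma>\<close> at \<open>m x\<close>.\<close>
  have zero: "s \<in> \<int>" if "(0, s) \<in> \<Gamma>'" for s
  proof -
    from that obtain a b m where ab: "(a, b) \<in> \<Gamma>" "0 = a + of_int m * x" "s = b + of_int m * y"
      by (auto simp: \<Gamma>'_def)
    have "of_int m * x = - a" using ab(2) by (simp add: eq_neg_iff_add_eq_0 add.commute)
    then have "m \<in> D" using partial_character_uminus[OF \<Gamma> ab(1)] by (auto simp: D_def)
    then obtain q where "m = q * d" using d(2) by (metis dvd_def mult.commute)
    then have "(of_int m * x, of_int m * y) \<in> \<Gamma>"
      using partial_character_mult_of_int[OF \<Gamma> d(1), of q] by (simp add: mult.assoc)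
    from partial_character_add[OF \<Gamma> ab(1) this] have "(0, s) \<in> \<Gamma>" using ab by simp
    then show ?thesis using partial_character_zero[OF \<Gamma>] by simp
  qed
  have "partial_character c \<Gamma>'"
    unfolding partial_character_def
  proof (intro conjI allI impI iffI)
    show "(1, c) \<in> \<Gamma>'" using \<Gamma> sub by (auto simp: partial_character_def)
    show "(0, s) \<in> \<Gamma>'" if "s \<in> \<int>" for s using that sub partial_character_zero[OF \<Gamma>] by auto
  qed (use diff zero in auto)
  then show thesis using that sub xy by blast
qed

text \<open>On the image of the integers take \<open>m\<close> to \<open>m c\<close>, where
  \<open>c\<close> is \<open>1 / p\<close> in characteristic \<open>p > 0\<close> and
  \<open>1 / 2\<close> in characteristic zero. In both cases an integer that vanishes in the field
  gets an integral value.\<close>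

lemma partial_character_exists:
  obtains c and \<Gamma> :: "('k::field \<times> real) set" where "c \<notin> \<int>" "partial_character c \<Gamma>"
proof -
  define c :: real where "c = (if CHAR('k) = 0 then 1 / 2 else 1 / of_nat CHAR('k))"
  have "CHAR('k) = 0 \<or> 1 < CHAR('k)" using CHAR_not_1[where 'a='k] by linarith
  then have "0 < c" "c < 1" by (auto simp: c_def)
  then have c: "c \<notin> \<int>" by (auto elim!: Ints_cases)
  have mc: "of_int m * c \<in> \<int>" if "(of_int m :: 'k) = 0" for m
  proof -
    obtain q where "m = int CHAR('k) * q"
      using \<open>(of_int m :: 'k) = 0\<close> by (auto simp: of_int_eq_0_iff_char_dvd)
    then show ?thesis by (simp add: c_def)
  qed
  define \<Gamma> :: "('k \<times> real) set" where "\<Gamma> = {(of_int m, of_int m * c + of_int n) | m n. True}"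
  have "partial_character c \<Gamma>"
    unfolding partial_character_def
  proof (intro conjI allI impI iffI)
    have "(1, c) = (of_int 1, of_int 1 * c + of_int 0)" by simp
    then show "(1, c) \<in> \<Gamma>" unfolding \<Gamma>_def by blast
    show "s \<in> \<int>" if s: "(0, s) \<in> \<Gamma>" for s
    proof -
      obtain m n where "(0::'k, s) = (of_int m, of_int m * c + of_int n)"
        using s unfolding \<Gamma>_def by blast
      then have "(of_int m :: 'k) = 0" "s = of_int m * c + of_int n" by simp_all
      then show ?thesis using mc[of m] by simp
    qed
    show "(0, s) \<in> \<Gamma>" if s: "s \<in> \<int>" for s
    proof -
      obtain n where "s = of_int n" using s by (auto elim: Ints_cases)
      then have "(0, s) = (of_int 0, of_int 0 * c + of_int n)" by simp
      then show ?thesis unfolding \<Gamma>_def by blast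
    qed
    show "(x - x', y - y') \<in> \<Gamma>" if xy: "(x, y) \<in> \<Gamma>" and xy': "(x', y') \<in> \<Gamma>" for x y x' y'
    proof -
      obtain m n where 1: "x = of_int m" "y = of_int m * c + of_int n" using xy by (auto simp: \<Gamma>_def)
      obtain m' n' where 2: "x' = of_int m'" "y' = of_int m' * c + of_int n'" using xy' by (auto simp: \<Gamma>_def)
      have "(x - x', y - y') = (of_int (m - m'), of_int (m - m') * c + of_int (n - n'))"
        using 1 2 by (simp add: algebra_simps)
      then show ?thesis unfolding \<Gamma>_def by blast
    qed
  qed
  then show thesis using that c by blast
qed

text \<open>Zorn's lemma yields a maximal partial character, which is total because any further
  element could be adjoined. \<open>\<kappa>\<close> selects a real representative of each value,
  hence is additive only modulo the integers.\<close>

lemma additive_character_exists: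
  obtains \<kappa> :: "'k::field \<Rightarrow> real"
  where "\<forall>x y. \<kappa> (x + y) - \<kappa> x - \<kappa> y \<in> \<int>" "\<kappa> 1 \<notin> \<int>"
proof -
  obtain c and \<Gamma>0 :: "('k \<times> real) set" where c: "c \<notin> \<int>" "partial_character c \<Gamma>0"
    using partial_character_exists .
  have "\<exists>\<Gamma>\<in>Collect (partial_character c). \<forall>\<Gamma>'\<in>Collect (partial_character c). \<Gamma> \<subseteq> \<Gamma>' \<longrightarrow> \<Gamma>' = (\<Gamma> :: ('k \<times> real) set)"
  proof (rule subset_Zorn_nonempty)
    show "Collect (partial_character c) \<noteq> ({} :: ('k \<times> real) set set)" using c by blast
    fix \<C> :: "('k \<times> real) set set"
    assume ne: "\<C> \<noteq> {}" and ch: "subset.chain (Collect (partial_character c)) \<C>"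
    have pc: "partial_character c \<Gamma>" if "\<Gamma> \<in> \<C>" for \<Gamma> using ch that by (auto simp: subset_chain_def)
    have "(x - x', y - y') \<in> \<Union>\<C>" if xy: "(x, y) \<in> \<Union>\<C>" and xy': "(x', y') \<in> \<Union>\<C>" for x y x' y'
    proof -
      obtain \<Gamma>1 \<Gamma>2 where 12: "\<Gamma>1 \<in> \<C>" "\<Gamma>2 \<in> \<C>" "(x, y) \<in> \<Gamma>1" "(x', y') \<in> \<Gamma>2" using xy xy' by blast
      have "\<Gamma>1 \<subseteq> \<Gamma>2 \<or> \<Gamma>2 \<subseteq> \<Gamma>1" using ch 12 by (auto simp: subset_chain_def)
      then obtain \<Gamma> where "\<Gamma> \<in> \<C>" "(x, y) \<in> \<Gamma>" "(x', y') \<in> \<Gamma>" using 12 by blast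
      then show ?thesis using partial_character_diff[OF pc] by blast
    qed
    moreover have "(1, c) \<in> \<Union>\<C>" using ne pc unfolding partial_character_def by blast
    moreover have "(0, s) \<in> \<Union>\<C> \<longleftrightarrow> s \<in> \<int>" for s
      using ne partial_character_zero[OF pc] by blast
    ultimately show "\<Union>\<C> \<in> Collect (partial_character c)" by (simp add: partial_character_def)
  qed
  then obtain \<Gamma> :: "('k \<times> real) set" where \<Gamma>: "partial_character c \<Gamma>"
    and max: "\<And>\<Gamma>'. partial_character c \<Gamma>' \<Longrightarrow> \<Gamma> \<subseteq> \<Gamma>' \<Longrightarrow> \<Gamma>' = \<Gamma>" by auto
  define \<kappa> where "\<kappa> x = (SOME y. (x, y) \<in> \<Gamma>)" for x
  have \<kappa>: "(x, \<kappa> x) \<in> \<Gamma>" for x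
  proof -
    obtain \<Gamma>' y where \<Gamma>': "partial_character c \<Gamma>'" "\<Gamma> \<subseteq> \<Gamma>'" "(x, y) \<in> \<Gamma>'"
      using partial_character_extend[OF \<Gamma>] .
    then have "(x, y) \<in> \<Gamma>" using max by blast
    then show ?thesis unfolding \<kappa>_def by (rule someI)
  qed
  have "\<kappa> (x + y) - \<kappa> x - \<kappa> y \<in> \<int>" for x y
  proof -
    have "(x + y - x - y, \<kappa> (x + y) - \<kappa> x - \<kappa> y) \<in> \<Gamma>"
      by (intro partial_character_diff[OF \<Gamma>] \<kappa>)
    then show ?thesis using partial_character_zero[OF \<Gamma>] by simp
  qed
  moreover have "\<kappa> 1 \<notin> \<int>"
  proof
    assume *: "\<kappa> 1 \<in> \<int>"
    have "(1 - 1, \<kappa> 1 - c) \<in> \<Gamma>"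
      using \<Gamma> by (intro partial_character_diff[OF \<Gamma>] \<kappa>) (simp add: partial_character_def)
    then have "\<kappa> 1 - c \<in> \<int>" using partial_character_zero[OF \<Gamma>] by simp
    from Ints_diff[OF * this] c(1) show False by simp
  qed
  ultimately show thesis using that by blast
qed

text \<open>Equality of the floors puts both fractional parts in one arc of length
  \<open>1 / N\<close>; the integer \<open>z\<close> is the difference of the integer parts.\<close>

lemma floor_mult_frac_eq:
  assumes "0 < N" "\<lfloor>N * frac a\<rfloor> = \<lfloor>N * frac b\<rfloor>"
  obtains z where "z \<in> \<int>" "\<bar>a - b - z\<bar> < 1 / (N::real)"
proof
  show "of_int (\<lfloor>a\<rfloor> - \<lfloor>b\<rfloor>) \<in> (\<int> :: real set)" by simp
  have "\<bar>N * frac a - N * frac b\<bar> < 1" using assms(2) by linarith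
  then have "N * \<bar>frac a - frac b\<bar> < 1"
    using assms(1) by (simp add: abs_mult flip: right_diff_distrib)
  then show "\<bar>a - b - of_int (\<lfloor>a\<rfloor> - \<lfloor>b\<rfloor>)\<bar> < 1 / N"
    using assms(1) by (simp add: frac_def field_simps)
qed

text \<open>
  A character into the circle with nontrivial value at \<open>1\<close>, coloured by short arcs.
\<close>

lemma field_colouring:
  fixes T :: "'t set"
  assumes T: "finite T"
  obtains col :: "'k::field \<Rightarrow> int" where "finite (range col)"
    "\<And>u w. (\<And>t. t \<in> T \<Longrightarrow> col (u t) = col (w t)) \<Longrightarrow> (\<Sum>t\<in>T. u t - w t) \<noteq> 1"
proof -
  obtain \<kappa> :: "'k \<Rightarrow> real" where add': "\<forall>x y. \<kappa> (x + y) - \<kappa> x - \<kappa> y \<in> \<int>" and one: "\<kappa> 1 \<notin> \<int>"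
    using additive_character_exists .
  from add' have add: "\<kappa> (x + y) - \<kappa> x - \<kappa> y \<in> \<int>" for x y by blast
  have zero: "\<kappa> 0 \<in> \<int>" using add[of 0 0] by simp
  have diff: "\<kappa> (x - y) - (\<kappa> x - \<kappa> y) \<in> \<int>" for x y
  proof -
    have "- (\<kappa> (x - y + y) - \<kappa> (x - y) - \<kappa> y) \<in> \<int>" using add by (rule Ints_minus)
    then show ?thesis by (simp add: algebra_simps)
  qed
  \<comment> \<open>The distance from \<open>\<kappa> 1\<close> to the nearest integer.\<close>
  define \<delta> where "\<delta> = min (frac (\<kappa> 1)) (1 - frac (\<kappa> 1))"
  have \<delta>: "0 < \<delta>" using one frac_lt_1[of "\<kappa> 1"] by (simp add: \<delta>_def frac_gt_0_iff)
  have far: "\<delta> \<le> \<bar>\<kappa> 1 - z\<bar>" if "z \<in> \<int>" for z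
  proof -
    obtain n where n: "z = of_int n" using \<open>z \<in> \<int>\<close> by (auto elim: Ints_cases)
    have "n \<le> \<lfloor>\<kappa> 1\<rfloor> \<or> \<lfloor>\<kappa> 1\<rfloor> + 1 \<le> n" by linarith
    then have "real_of_int n \<le> of_int \<lfloor>\<kappa> 1\<rfloor> \<or> of_int \<lfloor>\<kappa> 1\<rfloor> + 1 \<le> real_of_int n" by linarith
    then show ?thesis unfolding \<delta>_def frac_def n by linarith
  qed
  \<comment> \<open>The arcs are so short that \<open>card T\<close> errors of size
    \<open>1 / N\<close> stay below \<open>\<delta>\<close>.\<close>
  obtain N :: nat where N: "real (card T) / \<delta> < real N" using reals_Archimedean2 by blast
  have N0: "0 < real N" using N \<delta> by (meson divide_nonneg_pos of_nat_0_le_iff order_le_less_trans)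
  define col where "col x = \<lfloor>real N * frac (\<kappa> x)\<rfloor>" for x
  have "col x \<in> {0..int N}" for x
  proof -
    have "real N * frac (\<kappa> x) < real N * 1"
      using N0 frac_lt_1[of "\<kappa> x"] by (intro mult_strict_left_mono)
    moreover have "0 \<le> real N * frac (\<kappa> x)" by simp
    ultimately show ?thesis unfolding col_def atLeastAtMost_iff by linarith
  qed
  then have "range col \<subseteq> {0..int N}" by blast
  then have "finite (range col)" by (rule finite_subset) simp
  moreover have "(\<Sum>t\<in>T. u t - w t) \<noteq> 1" if eq: "\<And>t. t \<in> T \<Longrightarrow> col (u t) = col (w t)" for u w
  proof
    \<comment> \<open>Each monochromatic difference moves the value of \<open>\<kappa>\<close> away
      from the integers by at most \<open>1 / N\<close>.\<close>
    have step: "\<exists>z\<in>\<int>. \<bar>\<kappa> (\<Sum>t\<in>S. u t - w t) - z\<bar> \<le> real (card S) / real N" if "S \<subseteq> T" for S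
      using finite_subset[OF that T] that
    proof (induction S)
      case empty
      then show ?case using zero by (intro bexI[of _ "\<kappa> 0"]) auto
    next
      case (insert t S)
      then obtain z where z: "z \<in> \<int>" "\<bar>\<kappa> (\<Sum>t\<in>S. u t - w t) - z\<bar> \<le> real (card S) / real N" by blast
      obtain z' where z': "z' \<in> \<int>" "\<bar>\<kappa> (u t) - \<kappa> (w t) - z'\<bar> < 1 / real N"
        using floor_mult_frac_eq[OF N0, of "\<kappa> (u t)" "\<kappa> (w t)"] eq[of t] insert.prems by (auto simp: col_def)
      \<comment> \<open>\<open>e1\<close> and \<open>e2\<close> are the integral defects of
        additivity of \<open>\<kappa>\<close> at the difference and at the sum.\<close>
      define e1 where "e1 = \<kappa> (u t - w t) - (\<kappa> (u t) - \<kappa> (w t))"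
      define e2 where "e2 = \<kappa> ((u t - w t) + (\<Sum>t\<in>S. u t - w t)) - \<kappa> (u t - w t) - \<kappa> (\<Sum>t\<in>S. u t - w t)"
      have e: "e1 \<in> \<int>" "e2 \<in> \<int>" using diff add by (simp_all add: e1_def e2_def)
      have "\<bar>\<kappa> ((u t - w t) + (\<Sum>t\<in>S. u t - w t)) - (z + z' + e1 + e2)\<bar> \<le> real (card S) / real N + 1 / real N"
        using z(2) z'(2) unfolding e1_def e2_def by linarith
      also have "\<dots> = real (card (insert t S)) / real N"
        using insert.hyps by (simp add: add_divide_distrib)
      finally have "\<bar>\<kappa> (\<Sum>t\<in>insert t S. u t - w t) - (z + z' + e1 + e2)\<bar> \<le> real (card (insert t S)) / real N"
        using insert.hyps by simp
      moreover have "z + z' + e1 + e2 \<in> \<int>" using z(1) z'(1) e by (intro Ints_add)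
      ultimately show ?case by blast
    qed
    assume "(\<Sum>t\<in>T. u t - w t) = 1"
    with step[of T] obtain z where "z \<in> \<int>" "\<bar>\<kappa> 1 - z\<bar> \<le> real (card T) / real N" by auto
    with far have "\<delta> \<le> real (card T) / real N" by force
    moreover have "real (card T) / real N < \<delta>" using N \<delta> N0 by (simp add: field_simps)
    ultimately show False by linarith
  qed
  ultimately show thesis using that by blast
qed

subsection \<open>Pairing and annihilators\<close>

lemma pairing_superset:
  assumes "finite S" "Poly_Mapping.keys v \<subseteq> S"
  shows "pairing f v = (\<Sum>w\<in>S. Poly_Mapping.lookup v w * f w)"
  unfolding pairing_def
  by (rule sum.mono_neutral_left) (use assms in \<open>auto simp: in_keys_iff\<close>)

lemma pairing_cong: "(\<And>w. w \<in> Poly_Mapping.keys v \<Longrightarrow> f w = h w) \<Longrightarrow> pairing f v = pairing h v"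
  by (simp add: pairing_def)

lemma pairing_restrict: "v \<in> FW W \<Longrightarrow> pairing (restrict f W) v = pairing f v"
  by (intro pairing_cong) (auto simp: FW_def)

lemma pairing_zero_right [simp]: "pairing f 0 = 0"
  by (simp add: pairing_def)

lemma pairing_add_right: "pairing f (u + v) = pairing f u + pairing f v"
proof -
  let ?S = "Poly_Mapping.keys u \<union> Poly_Mapping.keys v"
  have "Poly_Mapping.keys (u + v) \<subseteq> ?S" by (rule Poly_Mapping.keys_add)
  then show ?thesis
    by (simp add: pairing_superset[of ?S] lookup_add distrib_right sum.distrib)
qed

lemma pairing_scale_right: "pairing f (fw_scale c v) = c * pairing f v"
proof -
  have "Poly_Mapping.keys (fw_scale c v) \<subseteq> Poly_Mapping.keys v" by (auto simp: in_keys_iff)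
  then show ?thesis
    by (simp add: pairing_superset[of "Poly_Mapping.keys v"] sum_distrib_left mult.assoc)
qed

lemma pairing_single [simp]: "pairing f (Poly_Mapping.single w c) = c * f w"
  by (simp add: pairing_superset[of "{w}"])

lemma pairing_sum_right: "pairing f (sum v S) = (\<Sum>s\<in>S. pairing f (v s))"
  by (induction S rule: infinite_finite_induct) (simp_all add: pairing_add_right)

lemma pairing_zero_left: "pairing (\<lambda>w. 0) v = 0"
  by (simp add: pairing_def)

lemma pairing_add_left: "pairing (\<lambda>w. f w + h w) v = pairing f v + pairing h v"
  by (simp add: pairing_def distrib_left sum.distrib)

lemma pairing_scale_left: "pairing (\<lambda>w. c * f w) v = c * pairing f v"
  by (simp add: pairing_def sum_distrib_left mult.left_commute)

lemma subspace_FW: "fw.subspace (FW W)"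
proof (rule fw.subspaceI)
  show "x + y \<in> FW W" if "x \<in> FW W" "y \<in> FW W" for x y
    using that Poly_Mapping.keys_add[of x y] by (auto simp: FW_def)
  show "fw_scale c x \<in> FW W" if "x \<in> FW W" for c x
    using that by (auto simp: FW_def in_keys_iff)
qed (simp add: FW_def)

lemma subspace_perp_of_funs: "fw.subspace (perp_of_funs W U)"
  unfolding perp_of_funs_def using subspace_FW[of W]
  by (auto simp: fw.subspace_def pairing_add_right pairing_scale_right)

lemma fun_subspace_perp_of_vecs:
  assumes "X \<subseteq> FW W"
  shows "fun_subspace W (perp_of_vecs W X)"
  using pairing_restrict[OF subsetD[OF assms]]
  by (auto simp: fun_subspace_def perp_of_vecs_def pairing_zero_left pairing_add_left pairing_scale_left)

lemma fun_subspace_Int: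
  "fun_subspace W U \<Longrightarrow> fun_subspace W U' \<Longrightarrow> fun_subspace W (U \<inter> U')"
  by (auto simp: fun_subspace_def)

section \<open>Linear functionals and separation\<close>

definition fw_functional :: "(('w \<Rightarrow>\<^sub>0 'k::field) \<Rightarrow> 'k) \<Rightarrow> bool" where
  "fw_functional \<psi> \<longleftrightarrow> (\<forall>x y. \<psi> (x + y) = \<psi> x + \<psi> y) \<and> (\<forall>c x. \<psi> (fw_scale c x) = c * \<psi> x)"

lemma fw_functional_sum:
  assumes "fw_functional \<psi>"
  shows "\<psi> (sum v S) = (\<Sum>s\<in>S. \<psi> (v s))"
proof -
  have "\<psi> (0 + 0) = \<psi> 0 + \<psi> 0" using assms unfolding fw_functional_def by blast
  then have "\<psi> 0 = 0" by (metis add.right_neutral add_cancel_right_right)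
  then show ?thesis
    using assms by (induction S rule: infinite_finite_induct) (simp_all add: fw_functional_def)
qed

lemma fw_functional_single:
  assumes "fw_functional \<psi>"
  shows "\<psi> (Poly_Mapping.single w c) = c * \<psi> (Poly_Mapping.single w 1)"
proof -
  have "Poly_Mapping.single w c = fw_scale c (Poly_Mapping.single w 1)"
    by (rule poly_mapping_eqI) (simp add: lookup_single when_def)
  then show ?thesis using assms by (simp add: fw_functional_def)
qed

lemma lookup_sum_single:
  assumes "finite S"
  shows "Poly_Mapping.lookup (\<Sum>w\<in>S. Poly_Mapping.single w (a w)) w = (if w \<in> S then a w else 0)"
  using assms by (simp add: lookup_sum lookup_single when_def)

text \<open>A functional is determined by its values on the basis vectors; this identifies the dual
  of the free vector space with the functions on its basis.\<close>

lemma fw_functional_eq_pairing: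
  assumes "fw_functional \<psi>"
  shows "\<psi> v = pairing (\<lambda>w. \<psi> (Poly_Mapping.single w 1)) v"
proof -
  have "v = (\<Sum>w\<in>Poly_Mapping.keys v. Poly_Mapping.single w (Poly_Mapping.lookup v w))"
    by (rule poly_mapping_eqI) (auto simp: lookup_sum_single in_keys_iff)
  then have "\<psi> v = (\<Sum>w\<in>Poly_Mapping.keys v. \<psi> (Poly_Mapping.single w (Poly_Mapping.lookup v w)))"
    using fw_functional_sum[OF assms] by metis
  also have "\<dots> = pairing (\<lambda>w. \<psi> (Poly_Mapping.single w 1)) v"
    unfolding pairing_def by (rule sum.cong[OF refl]) (rule fw_functional_single[OF assms])
  finally show ?thesis .
qed

text \<open>A basis of \<open>X\<close> stays independent after \<open>v\<close> is adjoined, so a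
  functional can be prescribed as \<open>1\<close> at \<open>v\<close> and \<open>0\<close> on that
  basis.\<close>

lemma fw_separation:
  fixes v :: "'w \<Rightarrow>\<^sub>0 'k::field"
  assumes "fw.subspace X" "v \<notin> X"
  obtains \<psi> where "fw_functional \<psi>" "\<forall>x\<in>X. \<psi> x = 0" "\<psi> v = 1"
proof -
  interpret vp: vector_space_pair "fw_scale :: 'k \<Rightarrow> ('w \<Rightarrow>\<^sub>0 'k) \<Rightarrow> _" "(*) :: 'k \<Rightarrow> 'k \<Rightarrow> 'k"
    by unfold_locales (auto simp: algebra_simps)
  obtain B where B: "B \<subseteq> X" "fw.independent B" "X \<subseteq> fw.span B"
    using fw.maximal_independent_subset[of X] .
  have "v \<notin> fw.span B" using assms fw.span_minimal[OF B(1) assms(1)] by blast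
  then have ind: "fw.independent (insert v B)" and vB: "v \<notin> B"
    using fw.independent_insertI[OF _ B(2)] fw.span_base by blast+
  obtain \<psi> where \<psi>: "Vector_Spaces.linear fw_scale (*) \<psi>"
    "\<forall>x\<in>insert v B. \<psi> x = (if x = v then 1 else 0 :: 'k)"
    using vp.linear_independent_extend[OF ind, of "\<lambda>x. if x = v then 1 else 0"] by blast
  have lin: "fw_functional \<psi>"
    using vp.linear_add[OF \<psi>(1)] vp.linear_scale[OF \<psi>(1)] by (simp add: fw_functional_def)
  have "\<psi> x = 0" if "x \<in> X" for x
  proof (rule fw.span_induct[of x B])
    show "x \<in> fw.span B" using that B(3) by blast
    show "fw.subspace {x. \<psi> x = 0}"
      using lin vp.linear_0[OF \<psi>(1)] by (auto simp: fw.subspace_def fw_functional_def)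
    show "\<psi> x = 0" if "x \<in> B" for x using \<psi>(2) vB that by auto
  qed
  then show thesis using that lin \<psi>(2) by simp
qed

subsection \<open>Closed subspaces\<close>

lemma openin_fun_cylinder:
  assumes "finite S" "S \<subseteq> W"
  shows "openin (fun_topology W) {h \<in> W \<rightarrow>\<^sub>E UNIV. \<forall>w\<in>S. h w = f w}"
proof -
  have "{h \<in> W \<rightarrow>\<^sub>E UNIV. \<forall>w\<in>S. h w = f w} = (\<Pi>\<^sub>E w\<in>W. if w \<in> S then {f w} else UNIV)"
  proof (intro set_eqI iffI)
    fix h assume h: "h \<in> (\<Pi>\<^sub>E w\<in>W. if w \<in> S then {f w} else UNIV)"
    have "h w = f w" if "w \<in> S" for w
      using PiE_mem[OF h subsetD[OF assms(2) that]] that by simp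
    then show "h \<in> {h \<in> W \<rightarrow>\<^sub>E UNIV. \<forall>w\<in>S. h w = f w}" using h by (simp add: PiE_iff)
  qed (simp add: PiE_iff)
  moreover have "{w \<in> W. (if w \<in> S then {f w} else UNIV) \<noteq> (UNIV :: 'b set)} \<subseteq> S" by auto
  then have "finite {w \<in> W. (if w \<in> S then {f w} else UNIV) \<noteq> (UNIV :: 'b set)}"
    using assms(1) finite_subset by blast
  ultimately show ?thesis
    by (simp add: fun_topology_def openin_PiE_gen)
qed

text \<open>The factors are discrete, so the cylinders over finite sets form a neighbourhood basis
  of each function; the right-hand side says that \<open>U\<close> contains its limit points in
  \<open>D\<close>.\<close>

lemma closedin_fun_iff:
  assumes "D \<subseteq> W \<rightarrow>\<^sub>E UNIV" "U \<subseteq> D"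
  shows "closedin (subtopology (fun_topology W) D) U \<longleftrightarrow>
    (\<forall>f\<in>D. (\<forall>S. finite S \<and> S \<subseteq> W \<longrightarrow> (\<exists>h\<in>U. \<forall>w\<in>S. h w = f w)) \<longrightarrow> f \<in> U)"
    (is "?closed \<longleftrightarrow> ?seq")
proof
  assume ?closed
  then obtain V where V: "openin (fun_topology W) V" "D - U = V \<inter> D"
    using assms unfolding closedin_def openin_subtopology
    by (auto simp: fun_topology_def topspace_subtopology Int_absorb1)
  show ?seq
  proof (intro ballI impI, rule ccontr)
    fix f assume f: "f \<in> D" "f \<notin> U"
      and dense: "\<forall>S. finite S \<and> S \<subseteq> W \<longrightarrow> (\<exists>h\<in>U. \<forall>w\<in>S. h w = f w)"
    then have "f \<in> V" using V(2) by blast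
    then obtain B where B: "finite {w \<in> W. B w \<noteq> (UNIV :: 'b set)}" "f \<in> Pi\<^sub>E W B" "Pi\<^sub>E W B \<subseteq> V"
      using V(1) unfolding fun_topology_def openin_product_topology_alt by auto
    obtain h where h: "h \<in> U" "\<And>w. w \<in> W \<Longrightarrow> B w \<noteq> UNIV \<Longrightarrow> h w = f w"
      using dense[rule_format, of "{w \<in> W. B w \<noteq> UNIV}"] B(1) by auto
    have hD: "h \<in> D" "h \<in> W \<rightarrow>\<^sub>E UNIV" using h(1) assms by auto
    have "h w \<in> B w" if "w \<in> W" for w
      using h(2)[OF that] B(2) that by (cases "B w = UNIV") auto
    then have "h \<in> Pi\<^sub>E W B" using hD(2) by (auto simp: PiE_iff)
    then show False using B(3) V(2) h(1) hD(1) by blast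
  qed
next
  assume ?seq
  have "openin (subtopology (fun_topology W) D) (D - U)"
  proof (subst openin_subopen, intro ballI)
    fix f assume f: "f \<in> D - U"
    have "\<not> (\<forall>S. finite S \<and> S \<subseteq> W \<longrightarrow> (\<exists>h\<in>U. \<forall>w\<in>S. h w = f w))"
      using bspec[OF \<open>?seq\<close>, of f] f by (intro notI) simp
    then obtain S where S: "finite S" "S \<subseteq> W" "\<not> (\<exists>h\<in>U. \<forall>w\<in>S. h w = f w)"
      unfolding not_all not_imp by (elim exE conjE) (rule that)
    let ?V = "{h \<in> W \<rightarrow>\<^sub>E UNIV. \<forall>w\<in>S. h w = f w}"
    have "openin (subtopology (fun_topology W) D) (D \<inter> ?V)"
      using openin_fun_cylinder[OF S(1,2)] by (rule openin_subtopology_Int2)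
    moreover have "f \<in> D \<inter> ?V" using f assms by auto
    moreover have "D \<inter> ?V \<subseteq> D - U" using S(3) by blast
    ultimately show "\<exists>T. openin (subtopology (fun_topology W) D) T \<and> f \<in> T \<and> T \<subseteq> D - U" by blast
  qed
  then show ?closed
    using assms unfolding closedin_def
    by (simp add: fun_topology_def topspace_subtopology Int_absorb1)
qed

text \<open>Restriction to \<open>S\<close> reduces the claim to a finite-dimensional space. If the
  restriction of \<open>f\<close> were outside that of \<open>U\<close>, a separating functional
  would be a vector supported on \<open>S\<close> that annihilates \<open>U\<close> but not
  \<open>f\<close>.\<close>

lemma double_perp_dense:
  fixes U :: "('w \<Rightarrow> 'k::field) set"
  assumes U: "fun_subspace W U" and S: "finite S" "S \<subseteq> W"
    and perp: "\<forall>x\<in>perp_of_funs W U. pairing f x = 0"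
  shows "\<exists>h\<in>U. \<forall>w\<in>S. h w = f w"
proof -
  define r where "r h = (\<Sum>w\<in>S. Poly_Mapping.single w (h w :: 'k))" for h
  have r: "Poly_Mapping.lookup (r h) w = (if w \<in> S then h w else 0)" for h w
    using S(1) by (simp add: r_def lookup_sum_single)
  have sub: "fw.subspace (r ` U)"
  proof (rule fw.subspaceI)
    have "r (\<lambda>w\<in>W. 0) = 0" using S(2) by (intro poly_mapping_eqI) (auto simp: r)
    moreover have "(\<lambda>w\<in>W. 0) \<in> U" using U by (simp add: fun_subspace_def)
    ultimately show "0 \<in> r ` U" by (metis imageI)
  next
    fix x y assume "x \<in> r ` U" "y \<in> r ` U"
    then obtain f h where fh: "f \<in> U" "h \<in> U" "x = r f" "y = r h" by blast
    have "x + y = r (\<lambda>w\<in>W. f w + h w)"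
      using S(2) fh by (intro poly_mapping_eqI) (auto simp: r lookup_add)
    moreover have "(\<lambda>w\<in>W. f w + h w) \<in> U" using U fh by (simp add: fun_subspace_def)
    ultimately show "x + y \<in> r ` U" by simp
  next
    fix c x assume "x \<in> r ` U"
    then obtain f where f: "f \<in> U" "x = r f" by blast
    have "fw_scale c x = r (\<lambda>w\<in>W. c * f w)"
      using S(2) f by (intro poly_mapping_eqI) (auto simp: r)
    moreover have "(\<lambda>w\<in>W. c * f w) \<in> U" using U f by (simp add: fun_subspace_def)
    ultimately show "fw_scale c x \<in> r ` U" by simp
  qed
  have "r f \<in> r ` U"
  proof (rule ccontr)
    assume "r f \<notin> r ` U"
    then obtain \<psi> where \<psi>: "fw_functional \<psi>" "\<forall>x\<in>r ` U. \<psi> x = 0" "\<psi> (r f) = 1"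
      using fw_separation[OF sub] by blast
    \<comment> \<open>\<open>x\<close> lists the values of \<open>\<psi>\<close> on the basis
      vectors over \<open>S\<close>; pairing with \<open>x\<close> is \<open>\<psi>\<close> after
      \<open>r\<close>.\<close>
    define x where "x = (\<Sum>w\<in>S. Poly_Mapping.single w (\<psi> (Poly_Mapping.single w 1)))"
    have pair: "pairing h x = \<psi> (r h)" for h
    proof -
      have "\<psi> (r h) = (\<Sum>w\<in>S. h w * \<psi> (Poly_Mapping.single w 1))"
        unfolding r_def fw_functional_sum[OF \<psi>(1)]
        by (rule sum.cong[OF refl]) (rule fw_functional_single[OF \<psi>(1)])
      then show ?thesis by (simp add: x_def pairing_sum_right mult.commute)
    qed
    have "x \<in> FW W" using S by (auto simp: FW_def in_keys_iff x_def lookup_sum_single split: if_splits)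
    then have "x \<in> perp_of_funs W U" using pair \<psi>(2) by (simp add: perp_of_funs_def)
    then have "pairing f x = 0" using perp by blast
    then show False using pair[of f] \<psi>(3) by simp
  qed
  then obtain h where h: "h \<in> U" "r f = r h" by blast
  have "h w = f w" if "w \<in> S" for w
    using arg_cong[OF h(2), of "\<lambda>v. Poly_Mapping.lookup v w"] that by (simp add: r)
  then show ?thesis using h(1) by blast
qed

text \<open>The adjunction that moves the action from vectors to functions. It holds for every map
  \<open>g\<close>, injective or not, because \<open>fw_act\<close> adds up the coefficients that
  land on the same basis vector.\<close>

lemma pairing_fw_act: "pairing f (fw_act g v) = pairing (\<lambda>w. f (meq_act g w)) v"
  unfolding fw_act_def by (simp add: pairing_sum_right pairing_def[of _ v])

subsection \<open>Automorphisms and imaginaries\<close>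

lemma trm_val_aut:
  assumes M: "is_struct L M" and g: "g \<in> aut L M"
  shows "trm_wf L t \<Longrightarrow> (\<And>i. i \<in> trm_vars t \<Longrightarrow> e i \<in> univ M \<and> e' i = g (e i)) \<Longrightarrow>
    trm_val M e t \<in> univ M \<and> trm_val M e' t = g (trm_val M e t)"
proof (induction t)
  case (Var i)
  then show ?case by simp
next
  case (App f ts)
  have ts: "trm_val M e t \<in> univ M \<and> trm_val M e' t = g (trm_val M e t)" if "t \<in> set ts" for t
    using App.IH[OF that] App.prems that by (auto simp: list_all_iff)
  have f: "f \<in> fsyms L" "map (trm_val M e) ts \<in> tuples (univ M) (farity L f)"
    using App.prems ts by (auto simp: tuples_def)
  have "map (trm_val M e') ts = map g (map (trm_val M e) ts)" using ts by simp
  then have "trm_val M e' (App f ts) = fn M f (map g (map (trm_val M e) ts))"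
    by (simp only: trm_val.simps)
  also have "\<dots> = g (fn M f (map (trm_val M e) ts))"
    using aut_embedding[OF g] f unfolding embedding_def by simp
  finally show ?case using fn_in_univ[OF M f] by simp
qed

text \<open>The assignments are related by \<open>g\<close> on the free variables only, because an
  assignment read off from a tuple is meaningful just at the indices below its length.\<close>

lemma sat_aut:
  assumes M: "is_struct L M" and g: "g \<in> aut L M"
  shows "fm_wf L p \<Longrightarrow> (\<And>i. i \<in> fm_free p \<Longrightarrow> e i \<in> univ M \<and> e' i = g (e i)) \<Longrightarrow> sat M e' p = sat M e p"
proof (induction p arbitrary: e e')
  case (Eq s t)
  have "trm_val M e s \<in> univ M \<and> trm_val M e' s = g (trm_val M e s)"
    "trm_val M e t \<in> univ M \<and> trm_val M e' t = g (trm_val M e t)"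
    using Eq by (auto intro!: trm_val_aut[OF M g])
  then show ?case using aut_inj[OF g] by (auto dest: inj_onD)
next
  case (Rel R ts)
  have ts: "trm_val M e t \<in> univ M \<and> trm_val M e' t = g (trm_val M e t)" if "t \<in> set ts" for t
    using Rel that by (intro trm_val_aut[OF M g]) (auto simp: list_all_iff)
  have R: "R \<in> rsyms L" "map (trm_val M e) ts \<in> tuples (univ M) (rarity L R)"
    using Rel.prems ts by (auto simp: tuples_def)
  have "map (trm_val M e') ts = map g (map (trm_val M e) ts)" using ts by simp
  then have "sat M e' (Rel R ts) \<longleftrightarrow> map g (map (trm_val M e) ts) \<in> rel M R"
    by (simp only: sat.simps)
  then show ?case using aut_embedding[OF g] R unfolding embedding_def by simp
next
  case (Neg p)
  then show ?case by simp
next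
  case (Conj p q)
  have "sat M e' p = sat M e p" by (rule Conj.IH(1)) (use Conj.prems in auto)
  moreover have "sat M e' q = sat M e q" by (rule Conj.IH(2)) (use Conj.prems in auto)
  ultimately show ?case by simp
next
  case (Ex i p)
  have "sat M (e'(i := g a)) p = sat M (e(i := a)) p" if "a \<in> univ M" for a
    by (rule Ex.IH) (use Ex.prems that in auto)
  \<comment> \<open>Witnesses for \<open>e'\<close> may be sought in the image of \<open>g\<close>,
    which is the whole universe.\<close>
  then have "sat M e' (Ex i p) \<longleftrightarrow> (\<exists>a\<in>g ` univ M. sat M (e'(i := a)) p)
      \<Longrightarrow> sat M e' (Ex i p) = sat M e (Ex i p)" by simp
  then show ?case using aut_image[OF g] by simp
qed

lemma definable_set_aut:
  assumes M: "is_struct L M" and D: "definable_set L M n D" and g: "g \<in> aut L M" and xs: "xs \<in> D"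
  shows "map g xs \<in> D"
proof -
  obtain p where p: "fm_wf L p" "fm_free p \<subseteq> {..<n}"
    "D = {xs \<in> tuples (univ M) n. sat M (\<lambda>i. xs ! i) p}"
    using D by (auto simp: definable_set_def)
  have tup: "xs \<in> tuples (univ M) n" using xs p by simp
  have "sat M (\<lambda>i. map g xs ! i) p = sat M (\<lambda>i. xs ! i) p"
  proof (rule sat_aut[OF M g p(1)])
    fix i assume "i \<in> fm_free p"
    then have "i < length xs" using p(2) tup by (auto simp: tuples_def)
    then show "xs ! i \<in> univ M \<and> map g xs ! i = g (xs ! i)" using tup by (auto simp: tuples_def)
  qed
  moreover have "map g xs \<in> tuples (univ M) n"
    using map_in_tuples[OF tup, of g "univ M"] aut_image[OF g] by simp
  ultimately show ?thesis using xs p(3) by simp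
qed

lemma meq_over_univ:
  assumes "c \<in> meq L M"
  shows "c \<noteq> {}" "xs \<in> c \<Longrightarrow> set xs \<subseteq> univ M"
proof -
  obtain n D E where D: "definable_set L M n D" and E: "equiv D E" and c: "c \<in> D // E"
    using assms by (auto simp: meq_def)
  show "c \<noteq> {}" using E c by (rule in_quotient_imp_non_empty)
  have "c \<subseteq> D" using in_quotient_imp_subset[OF E c] .
  then show "xs \<in> c \<Longrightarrow> set xs \<subseteq> univ M" using D by (auto simp: definable_set_def tuples_def)
qed

text \<open>The definable relation \<open>E\<close> is preserved by \<open>k\<close>, so
  \<open>d\<close> related to \<open>y\<close> gives \<open>map k d = d\<close> related to
  \<open>map k y\<close>.\<close>

lemma meq_stable:
  assumes M: "is_struct L M" and c: "c \<in> meq L M" and k: "k \<in> aut L M"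
    and d: "d \<in> c" "map k d = d" and y: "y \<in> c"
  shows "map k y \<in> c"
proof -
  obtain n D E where D: "definable_set L M n D"
    and E2: "definable_set L M (2 * n) {xs @ ys | xs ys. (xs, ys) \<in> E}"
    and E: "equiv D E" and cq: "c \<in> D // E"
    using c unfolding meq_def by blast
  have len: "length xs = n" if "xs \<in> D" for xs
    using D that by (auto simp: definable_set_def tuples_def)
  have ED: "xs \<in> D" "ys \<in> D" if "(xs, ys) \<in> E" for xs ys
    using that equiv_type[OF E] by auto
  have dy: "(d, y) \<in> E" using quotient_eq_iff[OF E cq cq d(1) y] by simp
  then have "d @ y \<in> {xs @ ys | xs ys. (xs, ys) \<in> E}" by blast
  from definable_set_aut[OF M E2 k this] obtain xs ys
    where xy: "map k d @ map k y = xs @ ys" "(xs, ys) \<in> E" by auto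
  have "length (map k d) = length xs" using len ED[OF xy(2)] ED[OF dy] by simp
  then have "xs = d" "ys = map k y" using xy(1) d(2) by auto
  then have "(d, map k y) \<in> E" using xy(2) by simp
  then show ?thesis using in_quotient_imp_closed[OF E cq d(1)] by simp
qed

section \<open>The action on imaginaries and on sorts\<close>

lemma meq_act_cong:
  assumes "\<And>xs. xs \<in> w \<Longrightarrow> set xs \<subseteq> A" "\<And>x. x \<in> A \<Longrightarrow> g x = h x"
  shows "meq_act g w = meq_act h w"
proof -
  have "map g xs = map h xs" if "xs \<in> w" for xs using assms that by auto
  then show ?thesis unfolding meq_act_def by (rule image_cong[OF refl])
qed

lemma meq_act_compose:
  assumes "\<And>xs. xs \<in> w \<Longrightarrow> set xs \<subseteq> A"
  shows "meq_act (compose A g h) w = meq_act g (meq_act h w)"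
proof -
  have "meq_act (compose A g h) w = meq_act (\<lambda>x. g (h x)) w"
    by (rule meq_act_cong[of w A]) (use assms in \<open>auto simp: compose_eq\<close>)
  then show ?thesis by (simp add: meq_act_def image_image comp_def)
qed

lemma meq_act_ident: "meq_act (\<lambda>x. x) w = w"
  by (simp add: meq_act_def)

text \<open>The inverse of \<open>g'\<close> after \<open>g\<close> fixes the entries of
  \<open>d\<close>, so it maps the class \<open>c\<close> into itself by \<open>meq_stable\<close>.
  An imaginary thus moves as any one representative does; the reverse inclusion follows by
  symmetry.\<close>

lemma meq_act_determined:
  assumes M: "is_struct L M" and c: "c \<in> meq L M" and d: "d \<in> c"
    and g: "g \<in> aut L M" and g': "g' \<in> aut L M" and eq: "map g d = map g' d"
  shows "meq_act g c \<subseteq> meq_act g' c"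
proof
  fix z assume "z \<in> meq_act g c"
  then obtain y where y: "y \<in> c" "z = map g y" by (auto simp: meq_act_def)
  define k where "k = compose (univ M) (restrict (inv_into (univ M) g') (univ M)) g"
  have k: "k \<in> aut L M" unfolding k_def by (rule aut_compose[OF aut_inv_into[OF g' M] g M])
  have kx: "k x = inv_into (univ M) g' (g x)" if "x \<in> univ M" for x
    using that aut_apply[OF g that] by (simp add: k_def compose_def)
  have "k x = x" if "x \<in> set d" for x
  proof -
    have x: "x \<in> univ M" using meq_over_univ(2)[OF c d] that by blast
    have "g x = g' x" using eq that by simp
    then show ?thesis using kx[OF x] inv_into_f_f[OF aut_inj[OF g'] x] by simp
  qed
  then have "map k d = d" by (rule map_idI)
  then have ky: "map k y \<in> c" using meq_stable[OF M c k d _ y(1)] by blast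
  have "g' (k x) = g x" if "x \<in> set y" for x
  proof -
    have x: "x \<in> univ M" using meq_over_univ(2)[OF c y(1)] that by blast
    have "g x \<in> g' ` univ M" using aut_apply[OF g x] aut_image[OF g'] by simp
    then show ?thesis using kx[OF x] f_inv_into_f by metis
  qed
  then have "map g' (map k y) = z" using y(2) by simp
  then show "z \<in> meq_act g' c" using ky unfolding meq_act_def by blast
qed

lemma sort_elem:
  assumes "is_sort L M W" "w \<in> W"
  obtains h c where "h \<in> aut L M" "c \<in> meq L M" "w = meq_act h c"
  using assms by (auto simp: is_sort_def orbit_def)

lemma sort_over_univ:
  assumes "is_sort L M W" "w \<in> W" "xs \<in> w"
  shows "set xs \<subseteq> univ M"
proof -
  obtain h c where h: "h \<in> aut L M" "c \<in> meq L M" "w = meq_act h c"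
    using sort_elem[OF assms(1,2)] .
  then obtain ys where ys: "ys \<in> c" "xs = map h ys" using assms(3) by (auto simp: meq_act_def)
  have "h ` set ys \<subseteq> h ` univ M" using meq_over_univ(2)[OF h(2) ys(1)] by (rule image_mono)
  then show ?thesis using ys(2) aut_image[OF h(1)] by simp
qed

lemma sort_act_compose:
  assumes "is_sort L M W" "w \<in> W"
  shows "meq_act (compose (univ M) g h) w = meq_act g (meq_act h w)"
  using sort_over_univ[OF assms] by (rule meq_act_compose)

lemma sort_act_cong:
  assumes "is_sort L M W" "w \<in> W" "\<And>x. x \<in> univ M \<Longrightarrow> g x = h x"
  shows "meq_act g w = meq_act h w"
  using sort_over_univ[OF assms(1,2)] assms(3) by (rule meq_act_cong)

lemma sort_act_in:
  assumes M: "is_struct L M" and W: "is_sort L M W" and w: "w \<in> W" and g: "g \<in> aut L M"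
  shows "meq_act g w \<in> W"
proof -
  obtain S where S: "S \<subseteq> meq L M" "W = (\<Union>c\<in>S. orbit (aut L M) meq_act c)"
    using W by (auto simp: is_sort_def)
  obtain c h where c: "c \<in> S" "h \<in> aut L M" "w = meq_act h c" using w S(2) by (auto simp: orbit_def)
  have "meq_act (compose (univ M) g h) c = meq_act g w"
    using meq_act_compose[of c "univ M" g h] meq_over_univ(2)[of c L M] c S(1) by auto
  then have "meq_act g w \<in> orbit (aut L M) meq_act c"
    using aut_compose[OF g c(2) M] unfolding orbit_def by (metis imageI)
  then show ?thesis using S(2) c(1) by blast
qed

text \<open>An element \<open>meq_act h c\<close> of the sort is supported by the entries of
  \<open>map h d\<close> for any tuple \<open>d\<close> in \<open>c\<close>, as
  \<open>meq_act_determined\<close> shows; finitely many such supports are united.\<close>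

lemma sort_finite_support:
  assumes M: "is_struct L M" and W: "is_sort L M W" and T: "finite T" "T \<subseteq> W"
  obtains S where "finite S" "S \<subseteq> univ M"
    "\<forall>g\<in>aut L M. \<forall>g'\<in>aut L M. (\<forall>x\<in>S. g x = g' x) \<longrightarrow> (\<forall>w\<in>T. meq_act g w = meq_act g' w)"
proof -
  have "\<exists>S. finite S \<and> S \<subseteq> univ M \<and>
    (\<forall>g\<in>aut L M. \<forall>g'\<in>aut L M. (\<forall>x\<in>S. g x = g' x) \<longrightarrow> meq_act g w = meq_act g' w)"
    if w: "w \<in> W" for w
  proof -
    obtain h c where h: "h \<in> aut L M" "c \<in> meq L M" "w = meq_act h c" using sort_elem[OF W w] .
    obtain d where d: "d \<in> c" using meq_over_univ(1)[OF h(2)] by blast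
    have hd: "h ` set d \<subseteq> univ M"
      using meq_over_univ(2)[OF h(2) d] aut_image[OF h(1)] by blast
    have act: "meq_act g w = meq_act (compose (univ M) g h) c" for g
      using meq_act_compose[of c "univ M" g h] meq_over_univ(2)[OF h(2)] h(3) by simp
    have "meq_act g w = meq_act g' w"
      if g: "g \<in> aut L M" "g' \<in> aut L M" and eq: "\<forall>x\<in>h ` set d. g x = g' x" for g g'
    proof -
      have m: "map (compose (univ M) g h) d = map (compose (univ M) g' h) d"
        using eq meq_over_univ(2)[OF h(2) d] by (auto simp: compose_def)
      note gh = aut_compose[OF g(1) h(1) M] aut_compose[OF g(2) h(1) M]
      show ?thesis
        using meq_act_determined[OF M h(2) d gh m] meq_act_determined[OF M h(2) d gh(2,1) m[symmetric]]
        by (simp add: act)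
    qed
    then show ?thesis using hd
      by (intro exI[of _ "h ` set d"] conjI ballI impI finite_imageI finite_set) blast+
  qed
  then obtain S where S: "\<And>w. w \<in> W \<Longrightarrow> finite (S w) \<and> S w \<subseteq> univ M \<and>
    (\<forall>g\<in>aut L M. \<forall>g'\<in>aut L M. (\<forall>x\<in>S w. g x = g' x) \<longrightarrow> meq_act g w = meq_act g' w)"
    by metis
  show thesis
  proof (rule that[of "\<Union>w\<in>T. S w"])
    show "finite (\<Union>w\<in>T. S w)" using S T by blast
    show "(\<Union>w\<in>T. S w) \<subseteq> univ M" using S T by blast
    show "\<forall>g\<in>aut L M. \<forall>g'\<in>aut L M. (\<forall>x\<in>\<Union>w\<in>T. S w. g x = g' x) \<longrightarrow> (\<forall>w\<in>T. meq_act g w = meq_act g' w)"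
    proof (intro ballI impI)
      fix g g' w assume g: "g \<in> aut L M" "g' \<in> aut L M"
        and eq: "\<forall>x\<in>\<Union>w\<in>T. S w. g x = g' x" and w: "w \<in> T"
      have "w \<in> W" using T(2) w by blast
      moreover have "\<forall>x\<in>S w. g x = g' x" using eq w by blast
      ultimately show "meq_act g w = meq_act g' w" using S g by blast
    qed
  qed
qed

subsection \<open>The correspondence\<close>

lemma fw_act_in_FW:
  assumes M: "is_struct L M" and W: "is_sort L M W" and g: "g \<in> aut L M" and v: "v \<in> FW W"
  shows "fw_act g v \<in> FW W"
  unfolding fw_act_def
proof (rule fw.subspace_sum[OF subspace_FW])
  fix w assume "w \<in> Poly_Mapping.keys v"
  then have "w \<in> W" using v by (auto simp: FW_def)
  then show "Poly_Mapping.single (meq_act g w) (Poly_Mapping.lookup v w) \<in> FW W"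
    using sort_act_in[OF M W _ g] by (simp add: FW_def)
qed

text \<open>\<open>fun_act\<close> involves the inverse of its automorphism, so acting by the
  inverse of \<open>g\<close> is precomposition with \<open>g\<close>. The double inverse is
  compared with \<open>g\<close> on the universe, which suffices since elements of the sort consist
  of tuples over it.\<close>

lemma fun_act_inverse:
  assumes M: "is_struct L M" and W: "is_sort L M W" and g: "g \<in> aut L M"
  shows "fun_act M W (restrict (inv_into (univ M) g) (univ M)) f = (\<lambda>w\<in>W. f (meq_act g w))"
proof -
  let ?k = "restrict (inv_into (univ M) g) (univ M)"
  have "inv_into (univ M) ?k x = g x" if "x \<in> univ M" for x
  proof -
    have "?k (g x) = x" using inv_into_f_f[OF aut_inj[OF g] that] aut_apply[OF g that] by simp
    then show ?thesis
      using inv_into_f_f[OF aut_inj[OF aut_inv_into[OF g M]] aut_apply[OF g that]] by simp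
  qed
  then have "meq_act (inv_into (univ M) ?k) w = meq_act g w" if "w \<in> W" for w
    using sort_act_cong[OF W that] by blast
  then show ?thesis unfolding fun_act_def by (intro restrict_ext) simp
qed

lemma fun_act_pairing:
  assumes W: "is_sort L M W" and v: "v \<in> FW W"
  shows "pairing (fun_act M W g f) v = pairing f (fw_act (restrict (inv_into (univ M) g) (univ M)) v)"
  unfolding pairing_fw_act
proof (rule pairing_cong)
  fix w assume "w \<in> Poly_Mapping.keys v"
  then have w: "w \<in> W" using v by (auto simp: FW_def)
  have "meq_act (inv_into (univ M) g) w = meq_act (restrict (inv_into (univ M) g) (univ M)) w"
    by (rule sort_act_cong[OF W w]) simp
  then show "fun_act M W g f w = f (meq_act (restrict (inv_into (univ M) g) (univ M)) w)"
    using w by (simp add: fun_act_def)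
qed

lemma perp_of_funs_in_G_submodules:
  assumes M: "is_struct L M" and W: "is_sort L M W"
    and inv: "\<forall>g\<in>aut L M. \<forall>f\<in>U. fun_act M W g f \<in> U"
  shows "perp_of_funs W U \<in> G_submodules L M W"
  unfolding G_submodules_def
proof (intro CollectI conjI ballI)
  show "perp_of_funs W U \<subseteq> FW W" by (auto simp: perp_of_funs_def)
  show "fw.subspace (perp_of_funs W U)" by (rule subspace_perp_of_funs)
  fix g x assume g: "g \<in> aut L M" and x: "x \<in> perp_of_funs W U"
  then have xW: "x \<in> FW W" by (simp add: perp_of_funs_def)
  have "pairing f (fw_act g x) = 0" if "f \<in> U" for f
  proof -
    have "(\<lambda>w\<in>W. f (meq_act g w)) \<in> U"
      using inv aut_inv_into[OF g M] that unfolding fun_act_inverse[OF M W g, symmetric] by blast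
    then have "pairing (\<lambda>w\<in>W. f (meq_act g w)) x = 0" using x by (simp add: perp_of_funs_def)
    then show ?thesis by (simp add: pairing_fw_act pairing_restrict[OF xW])
  qed
  then show "fw_act g x \<in> perp_of_funs W U"
    using fw_act_in_FW[OF M W g xW] by (simp add: perp_of_funs_def)
qed

lemma definable_funsI:
  assumes "f \<in> W \<rightarrow>\<^sub>E UNIV" "finite C" "C \<subseteq> univ M"
    "\<And>g w. g \<in> pt_stab L M C \<Longrightarrow> w \<in> W \<Longrightarrow> f (meq_act g w) = f w"
  shows "f \<in> definable_funs L M W"
  using assms by (auto simp: definable_funs_def orbit_def)

lemma definable_funsE:
  assumes "f \<in> definable_funs L M W"
  obtains C where "finite C" "C \<subseteq> univ M" "\<forall>g\<in>pt_stab L M C. \<forall>w\<in>W. f (meq_act g w) = f w"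
  using assms by (auto simp: definable_funs_def orbit_def)

lemma fun_subspace_definable_funs:
  assumes M: "is_struct L M" and W: "is_sort L M W"
  shows "fun_subspace W (definable_funs L M W)"
  unfolding fun_subspace_def
proof (intro conjI ballI allI)
  have gW: "meq_act g w \<in> W" if "g \<in> pt_stab L M C" "w \<in> W" for g w C
    using sort_act_in[OF M W] that by (auto simp: pt_stab_def)
  show "definable_funs L M W \<subseteq> W \<rightarrow>\<^sub>E UNIV" by (auto simp: definable_funs_def)
  show "(\<lambda>w\<in>W. 0) \<in> definable_funs L M W"
    by (rule definable_funsI[of _ _ "{}"]) (use gW in auto)
  show "(\<lambda>w\<in>W. c * f w) \<in> definable_funs L M W" if f: "f \<in> definable_funs L M W" for f c
  proof -
    obtain C where C: "finite C" "C \<subseteq> univ M" "\<forall>g\<in>pt_stab L M C. \<forall>w\<in>W. f (meq_act g w) = f w"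
      using definable_funsE[OF f] .
    show ?thesis by (rule definable_funsI[of _ _ C]) (use C gW in auto)
  qed
  show "(\<lambda>w\<in>W. f w + h w) \<in> definable_funs L M W"
    if f: "f \<in> definable_funs L M W" and h: "h \<in> definable_funs L M W" for f h
  proof -
    obtain C where C: "finite C" "C \<subseteq> univ M" "\<forall>g\<in>pt_stab L M C. \<forall>w\<in>W. f (meq_act g w) = f w"
      using definable_funsE[OF f] .
    obtain C' where C': "finite C'" "C' \<subseteq> univ M" "\<forall>g\<in>pt_stab L M C'. \<forall>w\<in>W. h (meq_act g w) = h w"
      using definable_funsE[OF h] .
    show ?thesis
    \<comment> \<open>The union of the two supports is a support of the sum.\<close>
    proof (rule definable_funsI[of _ _ "C \<union> C'"])
      fix g w assume g: "g \<in> pt_stab L M (C \<union> C')" and w: "w \<in> W"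
      then have "g \<in> pt_stab L M C" "g \<in> pt_stab L M C'" by (auto simp: pt_stab_def)
      then show "(\<lambda>w\<in>W. f w + h w) (meq_act g w) = (\<lambda>w\<in>W. f w + h w) w"
        using C(3) C'(3) gW[OF g w] w by simp
    qed (use C C' in auto)
  qed
qed

text \<open>If \<open>C\<close> supports \<open>f\<close>, then the image of \<open>C\<close> under
  \<open>g\<close> supports the translate: when \<open>h\<close> fixes that image pointwise, the
  conjugate of \<open>h\<close> by \<open>g\<close> fixes \<open>C\<close>.\<close>

lemma fun_act_definable:
  assumes M: "is_struct L M" and W: "is_sort L M W" and g: "g \<in> aut L M"
    and f: "f \<in> definable_funs L M W"
  shows "fun_act M W g f \<in> definable_funs L M W"
proof -
  obtain C where C: "finite C" "C \<subseteq> univ M" "\<forall>g\<in>pt_stab L M C. \<forall>w\<in>W. f (meq_act g w) = f w"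
    using definable_funsE[OF f] .
  let ?k = "restrict (inv_into (univ M) g) (univ M)"
  have k: "?k \<in> aut L M" by (rule aut_inv_into[OF g M])
  have kg: "?k (g x) = x" if "x \<in> univ M" for x
    using inv_into_f_f[OF aut_inj[OF g] that] aut_apply[OF g that] by simp
  have gk: "g (?k x) = x" if "x \<in> univ M" for x
    using f_inv_into_f[of x g "univ M"] aut_image[OF g] that by simp
  have act: "fun_act M W g f w = f (meq_act ?k w)" if "w \<in> W" for w
  proof -
    have "meq_act (inv_into (univ M) g) w = meq_act ?k w"
      by (rule sort_act_cong[OF W that]) simp
    then show ?thesis using that by (simp add: fun_act_def)
  qed
  show ?thesis
  proof (rule definable_funsI[of _ _ "g ` C"])
    show "fun_act M W g f \<in> W \<rightarrow>\<^sub>E UNIV" by (simp add: fun_act_def)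
    show "finite (g ` C)" using C by simp
    show "g ` C \<subseteq> univ M" using C(2) aut_image[OF g] by blast
    fix h w assume h: "h \<in> pt_stab L M (g ` C)" and w: "w \<in> W"
    have hM: "h \<in> aut L M" and hC: "\<And>x. x \<in> C \<Longrightarrow> h (g x) = g x" using h by (auto simp: pt_stab_def)
    define c where "c = compose (univ M) ?k (compose (univ M) h g)"
    have "c \<in> aut L M" unfolding c_def by (intro aut_compose k hM g M)
    moreover have "c x = x" if x: "x \<in> C" for x
    proof -
      have xM: "x \<in> univ M" using x C(2) by blast
      have "c x = ?k (h (g x))" unfolding c_def by (simp only: compose_eq[OF xM])
      then show ?thesis by (simp only: hC[OF x] kg[OF xM])
    qed
    ultimately have c: "c \<in> pt_stab L M C" by (simp add: pt_stab_def)
    have kw: "meq_act ?k w \<in> W" by (rule sort_act_in[OF M W w k])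
    have "meq_act c (meq_act ?k w) = meq_act (compose (univ M) c ?k) w"
      using sort_act_compose[OF W w] by simp
    also have "\<dots> = meq_act (compose (univ M) ?k h) w"
    proof (rule sort_act_cong[OF W w])
      fix x assume x: "x \<in> univ M"
      show "compose (univ M) c ?k x = compose (univ M) ?k h x"
        unfolding c_def by (simp only: compose_eq[OF x] compose_eq[OF aut_apply[OF k x]] gk[OF x])
    qed
    also have "\<dots> = meq_act ?k (meq_act h w)"
      using sort_act_compose[OF W w] by simp
    finally have "f (meq_act ?k (meq_act h w)) = f (meq_act ?k w)"
      using C(3) c kw by metis
    then show "fun_act M W g f (meq_act h w) = fun_act M W g f w"
      using act[OF w] act[OF sort_act_in[OF M W w hM]] by simp
  qed
qed

text \<open>Closedness holds because \<open>pairing f x\<close> involves only the finitely many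
  values of \<open>f\<close> on the keys of \<open>x\<close>; invariance is the adjunction applied
  to the inverse automorphism.\<close>

lemma perp_of_vecs_in_closed_G_subspaces:
  assumes M: "is_struct L M" and W: "is_sort L M W" and X: "X \<in> G_submodules L M W"
  shows "perp_of_vecs W X \<inter> definable_funs L M W \<in> closed_G_subspaces L M W"
proof -
  let ?D = "definable_funs L M W"
  have XW: "X \<subseteq> FW W" and inv: "\<And>g x. g \<in> aut L M \<Longrightarrow> x \<in> X \<Longrightarrow> fw_act g x \<in> X"
    using X by (auto simp: G_submodules_def)
  have D: "?D \<subseteq> W \<rightarrow>\<^sub>E UNIV" by (auto simp: definable_funs_def)
  have "fun_act M W g f \<in> perp_of_vecs W X"
    if g: "g \<in> aut L M" and f: "f \<in> perp_of_vecs W X" for g f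
  proof -
    have "pairing (fun_act M W g f) x = 0" if "x \<in> X" for x
      using fun_act_pairing[OF W subsetD[OF XW that]] inv[OF aut_inv_into[OF g M] that] f
      by (simp add: perp_of_vecs_def)
    then show ?thesis by (simp add: perp_of_vecs_def fun_act_def)
  qed
  moreover have "closedin (subtopology (fun_topology W) ?D) (perp_of_vecs W X \<inter> ?D)"
  proof (subst closedin_fun_iff[OF D], simp, intro ballI impI)
    fix f assume f: "f \<in> ?D"
      and dense: "\<forall>S. finite S \<and> S \<subseteq> W \<longrightarrow> (\<exists>h\<in>perp_of_vecs W X \<inter> ?D. \<forall>w\<in>S. h w = f w)"
    have "pairing f x = 0" if x: "x \<in> X" for x
    proof -
      have "Poly_Mapping.keys x \<subseteq> W" using x XW by (auto simp: FW_def)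
      then obtain h where h: "h \<in> perp_of_vecs W X" "\<forall>w\<in>Poly_Mapping.keys x. h w = f w"
        using dense finite_keys[of x] by blast
      then have "pairing f x = pairing h x" by (intro pairing_cong) simp
      then show ?thesis using h(1) x by (simp add: perp_of_vecs_def)
    qed
    then show "f \<in> perp_of_vecs W X \<inter> ?D" using f D by (auto simp: perp_of_vecs_def)
  qed
  ultimately show ?thesis
    using fun_act_definable[OF M W] fun_subspace_Int[OF fun_subspace_perp_of_vecs[OF XW] fun_subspace_definable_funs[OF M W]]
    by (auto simp: closed_G_subspaces_def)
qed

section \<open>The two maps are mutually inverse\<close>

lemma perp_of_vecs_perp_of_funs:
  assumes U: "U \<in> closed_G_subspaces L M W"
  shows "perp_of_vecs W (perp_of_funs W U) \<inter> definable_funs L M W = U"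
proof
  let ?D = "definable_funs L M W"
  have UD: "U \<subseteq> ?D" and sub: "fun_subspace W U" and cl: "closedin (subtopology (fun_topology W) ?D) U"
    using U by (auto simp: closed_G_subspaces_def)
  have D: "?D \<subseteq> W \<rightarrow>\<^sub>E UNIV" by (auto simp: definable_funs_def)
  show "U \<subseteq> perp_of_vecs W (perp_of_funs W U) \<inter> ?D"
    using UD D by (auto simp: perp_of_vecs_def perp_of_funs_def)
  show "perp_of_vecs W (perp_of_funs W U) \<inter> ?D \<subseteq> U"
  proof
    fix f assume f: "f \<in> perp_of_vecs W (perp_of_funs W U) \<inter> ?D"
    then have "\<forall>x\<in>perp_of_funs W U. pairing f x = 0" by (simp add: perp_of_vecs_def)
    \<comment> \<open>Elements of the double annihilator are matched by members of \<open>U\<close>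
      on every finite set; closedness then puts them in \<open>U\<close>.\<close>
    then have "\<forall>S. finite S \<and> S \<subseteq> W \<longrightarrow> (\<exists>h\<in>U. \<forall>w\<in>S. h w = f w)"
      using double_perp_dense[OF sub] by blast
    moreover have "f \<in> ?D" using f by simp
    ultimately show "f \<in> U" using cl unfolding closedin_fun_iff[OF D UD] by blast
  qed
qed

text \<open>This keeps the double annihilator of \<open>X\<close> from growing. The function comes
  from a functional that kills \<open>X\<close> and the differences in \<open>K\<close>.\<close>

lemma definable_separation:
  fixes L :: "('f, 'r) lang" and M :: "('a, 'f, 'r) struct" and v :: "'a list set \<Rightarrow>\<^sub>0 'k::field"
  assumes M: "is_struct L M" and R: "ramsey_structure L M" and W: "is_sort L M W"
    and X: "X \<in> G_submodules L M W" and v: "v \<in> FW W" "v \<notin> X"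
  shows "\<exists>f\<in>perp_of_vecs W X \<inter> definable_funs L M W. pairing f v \<noteq> 0"
proof -
  have XW: "X \<subseteq> FW W" and Xs: "fw.subspace X"
    and inv: "\<And>g x. g \<in> aut L M \<Longrightarrow> x \<in> X \<Longrightarrow> fw_act g x \<in> X"
    using X by (auto simp: G_submodules_def)
  have vW: "Poly_Mapping.keys v \<subseteq> W" using v by (simp add: FW_def)
  \<comment> \<open>Automorphisms that fix \<open>C\<close> pointwise fix every basis vector
    occurring in \<open>v\<close>.\<close>
  obtain C where C: "finite C" "C \<subseteq> univ M"
    and supp: "\<forall>g\<in>aut L M. \<forall>g'\<in>aut L M. (\<forall>x\<in>C. g x = g' x) \<longrightarrow>
      (\<forall>w\<in>Poly_Mapping.keys v. meq_act g w = meq_act g' w)"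
    using sort_finite_support[OF M W finite_keys vW] .
  define H where "H = pt_stab L M C"
  have HG: "h \<in> aut L M" if "h \<in> H" for h using that by (simp add: H_def pt_stab_def)
  have fix_v: "meq_act h w = w" if h: "h \<in> H" and w: "w \<in> Poly_Mapping.keys v" for h w
  proof -
    have "\<forall>x\<in>C. h x = (\<lambda>x\<in>univ M. x) x" using h C(2) by (auto simp: H_def pt_stab_def)
    then have "meq_act h w = meq_act (\<lambda>x\<in>univ M. x) w" using supp HG[OF h] aut_id[OF M] w by blast
    also have "\<dots> = meq_act (\<lambda>x. x) w"
      by (rule sort_act_cong[OF W]) (use w vW in auto)
    finally show ?thesis by (simp add: meq_act_ident)
  qed
  \<comment> \<open>A functional vanishes on \<open>K\<close> exactly when its values on the basis
    vectors over \<open>W\<close> are constant along the orbits of \<open>H\<close>, that is, when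
    they form a function supported by \<open>C\<close>.\<close>
  define K :: "('a list set \<Rightarrow>\<^sub>0 'k) set" where
    "K = {Poly_Mapping.single (meq_act h w) 1 - Poly_Mapping.single w 1 | h w. h \<in> H \<and> w \<in> W}"
  have "v \<notin> fw.span (X \<union> K)"
  proof
    assume "v \<in> fw.span (X \<union> K)"
    then obtain x y where xy: "v = x + y" "x \<in> fw.span X" "y \<in> fw.span K"
      unfolding fw.span_Un by blast
    have x: "x \<in> X" using xy(2) fw.span_minimal[OF subset_refl Xs] by blast
    obtain T r where T: "finite T" "T \<subseteq> K" and y: "y = (\<Sum>a\<in>T. fw_scale (r a) a)"
      using xy(3) unfolding fw.span_explicit by blast
    have "\<forall>a\<in>T. \<exists>h w. h \<in> H \<and> w \<in> W \<and> a = Poly_Mapping.single (meq_act h w) 1 - Poly_Mapping.single w 1"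
      using T(2) unfolding K_def by blast
    then obtain h w where hw: "\<forall>a\<in>T. h a \<in> H \<and> w a \<in> W \<and>
        a = Poly_Mapping.single (meq_act (h a) (w a)) 1 - Poly_Mapping.single (w a) 1"
      by metis
    \<comment> \<open>This \<open>\<psi>\<close> is only required to kill \<open>X\<close>. As
      \<open>X\<close> is invariant, every translate of \<open>\<psi>\<close> kills it as
      well.\<close>
    obtain \<psi> where \<psi>: "fw_functional \<psi>" "\<forall>x\<in>X. \<psi> x = 0" "\<psi> v = 1"
      using fw_separation[OF Xs v(2)] .
    define F where "F w = \<psi> (Poly_Mapping.single w 1)" for w
    have F: "\<psi> u = pairing F u" for u
      unfolding F_def by (rule fw_functional_eq_pairing[OF \<psi>(1)])
    \<comment> \<open>Translating by \<open>g\<close> in \<open>H\<close> keeps the value at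
      \<open>v\<close> equal to \<open>1\<close> and that at \<open>x\<close> equal to
      \<open>0\<close>, so the part in the span of \<open>K\<close> must contribute \<open>1\<close>
      for each \<open>g\<close>.\<close>
    have sum1: "(\<Sum>a\<in>T. r a * F (meq_act g (meq_act (h a) (w a))) - r a * F (meq_act g (w a))) = 1"
      if g: "g \<in> H" for g
    proof -
      let ?Fg = "\<lambda>w. F (meq_act g w)"
      have "1 = pairing F v" using \<psi>(3) F by simp
      also have "\<dots> = pairing ?Fg v" by (rule pairing_cong) (simp add: fix_v[OF g])
      also have "\<dots> = pairing ?Fg x + pairing ?Fg y" using xy(1) by (simp add: pairing_add_right)
      also have "pairing ?Fg x = 0"
        using inv[OF HG[OF g] x] \<psi>(2) F by (simp flip: pairing_fw_act)
      also have "pairing ?Fg y = (\<Sum>a\<in>T. r a * pairing ?Fg a)"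
        by (simp add: y pairing_sum_right pairing_scale_right)
      also have "\<dots> = (\<Sum>a\<in>T. r a * ?Fg (meq_act (h a) (w a)) - r a * ?Fg (w a))"
      proof (rule sum.cong[OF refl])
        fix a assume a: "a \<in> T"
        let ?p = "Poly_Mapping.single (meq_act (h a) (w a)) (1 :: 'k)" and ?q = "Poly_Mapping.single (w a) (1 :: 'k)"
        have pa: "a + ?q = ?p" using hw a by (metis diff_add_cancel)
        have "pairing ?Fg ?p = pairing ?Fg a + pairing ?Fg ?q"
          using pairing_add_right[of ?Fg a ?q] unfolding pa .
        then show "r a * pairing ?Fg a = r a * ?Fg (meq_act (h a) (w a)) - r a * ?Fg (w a)"
          by (simp add: algebra_simps)
      qed
      finally show ?thesis by simp
    qed
    obtain col :: "'k \<Rightarrow> int" where fin: "finite (range col)"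
      and col: "\<And>u w. (\<And>t. t \<in> T \<Longrightarrow> col (u t) = col (w t)) \<Longrightarrow> (\<Sum>t\<in>T. u t - w t) \<noteq> 1"
      using field_colouring[OF T(1)] by blast
    have wW: "w ` T \<subseteq> W" using hw by blast
    \<comment> \<open>A common support of all \<open>w a\<close>; the colouring
      \<open>\<phi>\<close> then depends only on the restriction of \<open>g\<close> to
      \<open>S\<close>.\<close>
    obtain S where S: "finite S" "S \<subseteq> univ M"
      and Ssupp: "\<forall>g\<in>aut L M. \<forall>g'\<in>aut L M. (\<forall>x\<in>S. g x = g' x) \<longrightarrow> (\<forall>u\<in>w ` T. meq_act g u = meq_act g' u)"
      using sort_finite_support[OF M W finite_imageI[OF T(1)] wW] .
    \<comment> \<open>One colouring records all terms at once. The coefficient \<open>r a\<close>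
      enters before colouring, so that the terms of \<open>sum1\<close> are plain differences of
      coloured elements.\<close>
    define \<phi> where "\<phi> g = (\<lambda>a\<in>T. col (r a * F (meq_act g (w a))))" for g
    have "\<exists>g\<in>pt_stab L M C. \<forall>k\<in>h ` T. \<phi> (compose (univ M) g k) = \<phi> g"
    proof (rule ramsey_pt_stab[OF M R C S])
      show "finite (h ` T)" using T(1) by simp
      show "h ` T \<subseteq> pt_stab L M C" using hw by (auto simp: H_def)
      have "\<phi> ` pt_stab L M C \<subseteq> T \<rightarrow>\<^sub>E range col" by (auto simp: \<phi>_def)
      then show "finite (\<phi> ` pt_stab L M C)"
        by (rule finite_subset) (intro finite_PiE T fin)
      fix g g' assume g: "g \<in> pt_stab L M C" "g' \<in> pt_stab L M C" and eq: "\<And>x. x \<in> S \<Longrightarrow> g x = g' x"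
      then have "\<forall>u\<in>w ` T. meq_act g u = meq_act g' u"
        using Ssupp HG by (simp add: H_def)
      then show "\<phi> g = \<phi> g'" unfolding \<phi>_def by (intro restrict_ext) simp
    qed
    then obtain g where g: "g \<in> H" and eq: "\<And>a. a \<in> T \<Longrightarrow> \<phi> (compose (univ M) g (h a)) = \<phi> g"
      by (auto simp: H_def)
    \<comment> \<open>Comparing \<open>\<phi>\<close> at coordinate \<open>a\<close> for
      \<open>g\<close> composed with \<open>h a\<close> and for \<open>g\<close> gives both parts of
      that difference the same colour.\<close>
    have "col (r a * F (meq_act g (meq_act (h a) (w a)))) = col (r a * F (meq_act g (w a)))" if a: "a \<in> T" for a
    proof -
      have "w a \<in> W" using hw a by blast
      then have "meq_act g (meq_act (h a) (w a)) = meq_act (compose (univ M) g (h a)) (w a)"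
        using sort_act_compose[OF W] by simp
      moreover have "\<phi> (compose (univ M) g (h a)) a = \<phi> g a" using eq[OF a] by simp
      ultimately show ?thesis using a by (simp add: \<phi>_def)
    qed
    then have "(\<Sum>a\<in>T. r a * F (meq_act g (meq_act (h a) (w a))) - r a * F (meq_act g (w a))) \<noteq> 1"
      by (rule col)
    then show False using sum1[OF g] by contradiction
  qed
  \<comment> \<open>This second functional kills \<open>K\<close> too, and its values on the basis
    give the definable function sought.\<close>
  then obtain \<psi> where \<psi>: "fw_functional \<psi>" "\<forall>x\<in>fw.span (X \<union> K). \<psi> x = 0" "\<psi> v = 1"
    using fw_separation[OF fw.subspace_span] by blast
  define f where "f = (\<lambda>w\<in>W. \<psi> (Poly_Mapping.single w 1))"
  have f: "pairing f u = \<psi> u" if "u \<in> FW W" for u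
    unfolding f_def pairing_restrict[OF that] by (rule fw_functional_eq_pairing[OF \<psi>(1), symmetric])
  have "f \<in> perp_of_vecs W X"
    unfolding perp_of_vecs_def
  proof (intro CollectI conjI ballI)
    show "pairing f x = 0" if "x \<in> X" for x
      using f[OF subsetD[OF XW that]] \<psi>(2) fw.span_base[of x "X \<union> K"] that by simp
  qed (simp add: f_def)
  moreover have "f \<in> definable_funs L M W"
  proof (rule definable_funsI[OF _ C])
    fix g w assume g: "g \<in> pt_stab L M C" and w: "w \<in> W"
    let ?p = "Poly_Mapping.single (meq_act g w) (1 :: 'k)" and ?q = "Poly_Mapping.single w (1 :: 'k)"
    have "?p - ?q \<in> K" using g w unfolding K_def H_def by blast
    then have "\<psi> (?p - ?q) = 0" using \<psi>(2) fw.span_base[of "?p - ?q" "X \<union> K"] by simp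
    moreover have "\<psi> ?p = \<psi> (?p - ?q) + \<psi> ?q"
      using \<psi>(1) unfolding fw_functional_def by (metis diff_add_cancel)
    moreover have "meq_act g w \<in> W" using sort_act_in[OF M W w] g by (simp add: pt_stab_def)
    ultimately show "f (meq_act g w) = f w" using w by (simp add: f_def)
  qed (simp add: f_def)
  moreover have "pairing f v \<noteq> 0" using f[OF v(1)] \<psi>(3) by simp
  ultimately show ?thesis by blast
qed

text \<open>One inclusion is formal; for the other, a vector outside \<open>X\<close> is detected by
  a function from \<open>definable_separation\<close>.\<close>

lemma perp_of_funs_perp_of_vecs:
  assumes M: "is_struct L M" and R: "ramsey_structure L M" and W: "is_sort L M W"
    and X: "X \<in> G_submodules L M W"
  shows "perp_of_funs W (perp_of_vecs W X \<inter> definable_funs L M W) = X"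
proof
  show "X \<subseteq> perp_of_funs W (perp_of_vecs W X \<inter> definable_funs L M W)"
    using X by (auto simp: perp_of_funs_def perp_of_vecs_def G_submodules_def)
  show "perp_of_funs W (perp_of_vecs W X \<inter> definable_funs L M W) \<subseteq> X"
    using definable_separation[OF M R W X] by (fastforce simp: perp_of_funs_def)
qed

theorem corollary3p4:
  fixes L :: "('f, 'r) lang"
    and M :: "('a, 'f, 'r) struct"
    and W :: "'a list set set"
  assumes "is_struct L M"
    and "omega_categorical L M"
    and "ramsey_structure L M"
    and "is_sort L M W"
  shows
    "bij_betw (perp_of_funs W)
        (closed_G_subspaces L M W :: ('a list set \<Rightarrow> 'k::field) set set) (G_submodules L M W) \<and>
     bij_betw (\<lambda>X. perp_of_vecs W X \<inter> definable_funs L M W)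
        (G_submodules L M W) (closed_G_subspaces L M W :: ('a list set \<Rightarrow> 'k) set set) \<and>
     (\<forall>U \<in> (closed_G_subspaces L M W :: ('a list set \<Rightarrow> 'k) set set).
        perp_of_vecs W (perp_of_funs W U) \<inter> definable_funs L M W = U) \<and>
     (\<forall>X \<in> (G_submodules L M W :: ('a list set \<Rightarrow>\<^sub>0 'k) set set).
        perp_of_funs W (perp_of_vecs W X \<inter> definable_funs L M W) = X) \<and>
     monotone_on (closed_G_subspaces L M W :: ('a list set \<Rightarrow> 'k) set set) (\<subseteq>) (\<supseteq>)
        (perp_of_funs W) \<and>
     monotone_on (G_submodules L M W :: ('a list set \<Rightarrow>\<^sub>0 'k) set set) (\<subseteq>) (\<supseteq>)
        (\<lambda>X. perp_of_vecs W X \<inter> definable_funs L M W)"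
proof -
  note M = assms(1) and R = assms(3) and W = assms(4)
  let ?U = "closed_G_subspaces L M W :: ('a list set \<Rightarrow> 'k) set set"
  let ?X = "G_submodules L M W :: ('a list set \<Rightarrow>\<^sub>0 'k) set set"
  let ?p = "perp_of_funs W :: ('a list set \<Rightarrow> 'k) set \<Rightarrow> _"
  let ?q = "\<lambda>X :: ('a list set \<Rightarrow>\<^sub>0 'k) set. perp_of_vecs W X \<inter> definable_funs L M W"
  have p: "?p ` ?U \<subseteq> ?X"
    using perp_of_funs_in_G_submodules[OF M W] by (auto simp: closed_G_subspaces_def)
  have q: "?q ` ?X \<subseteq> ?U"
    using perp_of_vecs_in_closed_G_subspaces[OF M W] by blast
  have qp: "\<forall>U\<in>?U. ?q (?p U) = U" using perp_of_vecs_perp_of_funs by blast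
  have pq: "\<forall>X\<in>?X. ?p (?q X) = X" using perp_of_funs_perp_of_vecs[OF M R W] by blast
  have "bij_betw ?p ?U ?X" by (rule bij_betw_byWitness[OF qp pq p q])
  moreover have "bij_betw ?q ?X ?U" by (rule bij_betw_byWitness[OF pq qp q p])
  moreover have "monotone_on ?U (\<subseteq>) (\<supseteq>) ?p"
    by (rule monotone_onI) (auto simp: perp_of_funs_def)
  moreover have "monotone_on ?X (\<subseteq>) (\<supseteq>) ?q"
    by (rule monotone_onI) (auto simp: perp_of_vecs_def)
  ultimately show ?thesis using qp pq by blast
qed

end
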